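(* Let $m\geq 3$ and let $\chi_1,\chi_2$ be multiplicative characters modulo $2^m$ with $\chi_2$ primitive. Let $A,B,k$ be integers with $k\geq 1$, $A$ even and $B$ odd, and write $$A=2^nA_1,\ n>0,\qquad k=2^tk_1,\qquad 2\nmid A_1k_1B,$$ and set $$S=\sum_{x=1}^{2^m}\chi_1(x)\chi_2(Ax^k+B).$$ Let $c_1,c_2$ be the integers with $\chi_i(5)=e_{2^{m-2}}(c_i)$ and $1\leq c_i\leq 2^{m-2}$ ($i=1,2$), where $e_q(x)=e^{2\pi i x/q}$. For $i\geq 2$ let $R_i$ be the odd integer defined by $5^{2^{i-2}}=1+R_i2^i$. Define $$N:=\begin{cases}\lceil \tfrac12(m-n)\rceil, & \text{if } m-n>2t+4,\\ t+2, & \text{if } t+2\leq m-n\leq 2t+4,\end{cases}$$ and $$C(x):=c_1(Ax^k+B)+c_2Akx^kR_NR_{N+n}^{-1},$$ where $R_{N+n}^{-1}$ denotes the inverse of $R_{N+n}$ modulo $2^m$. By the characteristic equation we mean the congruence $$C(x_0)\equiv 0 \pmod{2^{\lfloor \frac12(m+n)\rfloor+t}}$$ in an integer $x_0$ with $2\nmid x_0(Ax_0^k+B)$. Suppose that $m-n\geq t+2$. Then $S=0$ unless all of the following hold: $c_1=2^{n+t}c_3$ with $c_3$ an odd integer; $\chi_1(-1)=1$ if $k$ is even; and, when $m-n>2t+4$, the characteristic equation has an odd solution $x_0$. Assume these conditions hold. Then: (i) If $m-n>2t+4$, let $x_0$ be an odd solution of the characteristic equation, write $C(x_0)=\lambda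 2^{\lfloor\frac12(m+n)\rfloor+t}$ with $\lambda\in\mathbb Z$, and put $h:=2\lambda+(k_1-1)+(2^n-1)c_3$. Then $$S=2^{\frac12(m+n)+t+\min\{1,t\}}\chi_1(x_0)\chi_2(Ax_0^k+B)\cdot\begin{cases}1, & \text{if } m-n \text{ is even},\\ \omega^h\left(\frac{2}{h}\right), & \text{if } m-n \text{ is odd},\end{cases}$$ where $\omega=e^{\pi i/4}$ and $\left(\frac{2}{h}\right)$ is the Jacobi symbol. (ii) If $t+3<m-n\leq 2t+4$, then $$S=\begin{cases}2^{m-1}\chi_2(A+B), & \text{if } k \text{ is even and } C(1)\equiv 0 \bmod 2^{m-2},\\ 2^{m-2}\chi_2(A+B), & \text{if } k \text{ is odd and } C(1)\equiv 0 \bmod 2^{m-2},\\ 2^{m-2}\chi_1(-1)\chi_2(-A+B), & \text{if } k \text{ is odd and } C(-1)\equiv 0 \bmod 2^{m-2},\\ 0, & \text{otherwise}.\end{cases}$$ (iii) If $m-n=t+3$, then $$S=\begin{cases}2^{m-1}\chi_2(A+B), & \text{if } k \text{ is even and } \chi_1(5)=\pm1,\ \chi_1(-1)=1,\\ 2^{m-2}\bigl(\chi_2(A+B)+\chi_1(-1)\chi_2(-A+B)\bigr), & \text{if } k \text{ is odd and } \chi_1(5)=\pm 1,\\ 0, & \text{otherwise}.\end{cases}$$ (iv) If $m-n=t+2$, then $$S=\begin{cases}2^{m-1}\chi_2(A+B), & \text{if } k \text{ is even and } \chi_1=\chi_0, \text{ or } k \text{ is odd and } \chi_1=\chi_4,\\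 0, & \text{otherwise},\end{cases}$$ where $\chi_0$ is the principal character modulo $2^m$ and $\chi_4$ is the character modulo $2^m$ induced by the non-trivial character modulo $4$ (i.e. $\chi_4(x)=\pm1$ according as $x\equiv\pm1 \bmod 4$).
   Context: Characters modulo $2^m$ are extended by $\chi(x)=0$ for even $x$. Since $(\mathbb Z/2^m\mathbb Z)^*$ is generated by $-1$ and $5$, with $5$ of order $2^{m-2}$, each character mod $2^m$ is determined by its values at $-1$ and $5$; primitivity of $\chi_2$ means $c_2$ is odd. Throughout, $y^{-1}$ denotes the inverse of an odd integer $y$ modulo $2^m$. *)

theory Defs
  imports "HOL-Analysis.Analysis" "HOL-Number_Theory.Number_Theory"
begin

definition dchar :: "int \<Rightarrow> (int \<Rightarrow> complex) \<Rightarrow> bool" where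
  "dchar q chi \<longleftrightarrow> q > 0 \<and> chi 1 = 1 \<and>
     (\<forall>x y. chi (x * y) = chi x * chi y) \<and>
     (\<forall>x. chi (x + q) = chi x) \<and>
     (\<forall>x. \<not> coprime x q \<longrightarrow> chi x = 0)"

definition primitive_dchar :: "int \<Rightarrow> (int \<Rightarrow> complex) \<Rightarrow> bool" where
  "primitive_dchar q chi \<longleftrightarrow> dchar q chi \<and>
     (\<forall>d. d > 0 \<and> d dvd q \<and> d < q \<longrightarrow>
        (\<exists>x. coprime x q \<and> [x = 1] (mod d) \<and> chi x \<noteq> 1))"

definition chi0_2 :: "int \<Rightarrow> complex" where
  "chi0_2 x = (if odd x then 1 else 0)"

definition chi4 :: "int \<Rightarrow> complex" where
  "chi4 x = (if odd x then (if x mod 4 = 1 then 1 else -1) else 0)"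

definition eq :: "int \<Rightarrow> int \<Rightarrow> complex" where
  "eq q x = exp (2 * pi * \<i> * of_int x / of_int q)"

text \<open>R_i defined by 5^(2^(i-2)) = 1 + R_i 2^i (for i \<ge> 2).\<close>
definition R :: "nat \<Rightarrow> int" where
  "R i = (5 ^ (2 ^ (i - 2)) - 1) div 2 ^ i"

text \<open>Jacobi symbol (a/n), n odd; for negative n we use |n| (Kronecker convention).\<close>
definition jacobi :: "int \<Rightarrow> int \<Rightarrow> int" where
  "jacobi a n = (\<Prod>p\<in>prime_factors (nat \<bar>n\<bar>). Legendre a (int p) ^ multiplicity p (nat \<bar>n\<bar>))"

end

theory Submission
  imports Defs
begin

text \<open>
Write \<open>f x = \<chi>\<^sub>1 x * \<chi>\<^sub>2 (A x\<^sup>k + B)\<close>, \<open>j = N - t\<close> and \<open>u = 5^(2^(j-2))\<close>, a generator of the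
residues congruent to 1 modulo \<open>2^j\<close>. The choice of \<open>N\<close> makes the binomial expansion of \<open>u^(ks)\<close>
linear in \<open>s\<close> modulo \<open>2^(m-n)\<close>, so \<open>f (a u^s) = f a * \<zeta>^s\<close>, where \<open>\<zeta>\<close> is a root of unity of order
dividing \<open>2^(m-j)\<close> which equals 1 exactly when \<open>C a \<equiv> 0 (mod 2^(m-j))\<close>. Hence the sum of \<open>f\<close> over
a residue class \<open>a\<close> modulo \<open>2^j\<close> is \<open>2^(m-j) f a\<close> or 0, and only the classes that solve the
characteristic equation survive. For \<open>m - n \<le> 2t + 4\<close> one has \<open>j = 2\<close>, and the classes are those of 1
and -1. For \<open>m - n > 2t + 4\<close> the characteristic equation fixes \<open>x^k\<close> modulo \<open>2^(m-n-N)\<close>, so its solutions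
are \<open>\<plusminus>x\<^sub>0\<close> modulo \<open>2^(m-n-N-t)\<close>. When \<open>m - n\<close> is even this modulus is \<open>2^j\<close>. When \<open>m - n\<close> is odd it is
\<open>2^(j-1)\<close>, a second class \<open>x\<^sub>0 v\<close> with \<open>v\<^sup>2 = u\<close> appears, and \<open>f (x\<^sub>0 v) = \<i>^h f x\<^sub>0\<close>; the factor of the
theorem comes from \<open>1 + \<i>^h = sqrt 2 * \<omega>^h * (2/h)\<close>.
\<close>

subsection \<open>Roots of unity\<close>

lemma eq_add: "eq q (x + y) = eq q x * eq q y"
  by (simp add: eq_def exp_add[symmetric] add_divide_distrib ring_distribs)

lemma eq_0 [simp]: "eq q 0 = 1"
  by (simp add: eq_def)

lemma eq_power: "eq q x ^ s = eq q (int s * x)"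
  by (induction s) (simp_all add: eq_add ring_distribs)

lemma eq_conv_cis: "eq q x = cis (2 * pi * (of_int x / of_int q))"
  by (simp add: eq_def cis_conv_exp mult_ac)

lemma eq_eq_1_iff:
  assumes "q > 0"
  shows "eq q x = 1 \<longleftrightarrow> q dvd x"
proof -
  have "eq q x = 1 \<longleftrightarrow> (\<exists>n::int. 2 * pi * (of_int x / of_int q) = of_int (2 * n) * pi)"
    unfolding eq_conv_cis cis_conv_exp
    by (simp only: exp_eq_1 Re_i_times Im_i_times Re_complex_of_real Im_complex_of_real) simp
  also have "\<dots> \<longleftrightarrow> (\<exists>n::int. real_of_int x = of_int (n * q))"
    using assms by (intro ex_cong1) (auto simp: field_simps)
  also have "\<dots> \<longleftrightarrow> q dvd x"
    unfolding of_int_eq_iff by (auto simp: dvd_def mult.commute)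
  finally show ?thesis .
qed

lemma eq_cong:
  assumes "q > 0" "[x = y] (mod q)"
  shows "eq q x = eq q y"
proof -
  have "eq q (x - y) = 1"
    using assms by (simp add: eq_eq_1_iff cong_iff_dvd_diff)
  then show ?thesis
    using eq_add[of q "x - y" y] by simp
qed

lemma eq_mult_cancel: "d \<noteq> 0 \<Longrightarrow> eq (d * q) (d * x) = eq q x"
  by (simp add: eq_conv_cis)

lemma eq_power_two_cancel: "eq (2 ^ (i + l)) (2 ^ i * x) = eq (2 ^ l) x"
  unfolding power_add by (rule eq_mult_cancel) simp

lemma eq_2_odd:
  assumes "odd x"
  shows "eq 2 x = - 1"
proof -
  have "eq 2 x ^ 2 = 1" "eq 2 x \<noteq> 1"
    using assms by (simp_all add: eq_power eq_eq_1_iff)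
  then show ?thesis by (simp add: power2_eq_1_iff)
qed

lemma sum_eq_multiples:
  fixes Q :: nat
  assumes "Q > 0"
  shows "(\<Sum>s<Q. eq (int Q) (int s * x)) = (if int Q dvd x then of_nat Q else 0)"
proof (cases "int Q dvd x")
  case True
  then have "eq (int Q) (int s * x) = 1" for s
    using assms by (simp add: eq_eq_1_iff)
  then show ?thesis using True by simp
next
  case False
  have "eq (int Q) x \<noteq> 1" "eq (int Q) x ^ Q = 1"
    using False assms by (simp_all add: eq_eq_1_iff eq_power)
  then have "(\<Sum>s<Q. eq (int Q) x ^ s) = 0"
    by (simp add: geometric_sum)
  then show ?thesis using False by (simp add: eq_power)
qed

subsection \<open>Congruences modulo powers of two\<close>

lemma cong_power_le:
  fixes a b :: int
  assumes "[a = b] (mod p ^ m)" "l \<le> m"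
  shows "[a = b] (mod p ^ l)"
  using assms by (meson cong_dvd_modulus le_imp_power_dvd)

lemma cong_power_mult:
  fixes a b :: int
  assumes "[a = b] (mod p ^ l)" "m \<le> i + l"
  shows "[p ^ i * a = p ^ i * b] (mod p ^ m)"
proof -
  have "p ^ (i + l) dvd p ^ i * (a - b)"
    using assms(1) by (simp add: power_add cong_iff_dvd_diff mult_dvd_mono)
  then have "p ^ m dvd p ^ i * (a - b)"
    using assms(2) by (rule power_le_dvd)
  then show ?thesis by (simp add: cong_iff_dvd_diff right_diff_distrib)
qed

lemma one_plus_power_cong: "[(1 + x) ^ s = 1 + int s * x] (mod x ^ 2)"
proof (induction s)
  case (Suc s)
  have "[(1 + x) * (1 + x) ^ s = (1 + x) * (1 + int s * x)] (mod x ^ 2)"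
    by (rule cong_scalar_left[OF Suc.IH])
  also have "(1 + x) * (1 + int s * x) = 1 + int (Suc s) * x + x ^ 2 * int s"
    by (simp add: algebra_simps power2_eq_square)
  also have "[\<dots> = 1 + int (Suc s) * x] (mod x ^ 2)"
    by (simp add: cong_def)
  finally show ?case by simp
qed simp

lemma odd_cong_half_modulus_cancel:
  fixes v x z :: int
  assumes "odd v" "[v * x = 2 ^ l * z] (mod 2 ^ Suc l)"
  shows "[x = 2 ^ l * z] (mod 2 ^ Suc l)"
proof -
  have "[2 ^ l * z = 2 ^ l * (v * z)] (mod 2 ^ Suc l)"
  proof (rule cong_power_mult)
    show "[z = v * z] (mod 2 ^ 1)" using assms(1) by (simp add: cong_iff_dvd_diff)
  qed simp
  with assms(2) have "[v * x = 2 ^ l * (v * z)] (mod 2 ^ Suc l)" by (rule cong_trans)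
  then have "[v * x = v * (2 ^ l * z)] (mod 2 ^ Suc l)" by (simp only: mult.left_commute)
  moreover have "coprime v (2 ^ Suc l)" using assms(1) by simp
  ultimately show ?thesis using cong_mult_lcancel by blast
qed

lemma cong_mod_4_odd_cases:
  fixes a :: int
  assumes "odd a"
  shows "[a = 1] (mod 4) \<or> [a = - 1] (mod 4)"
  using assms unfolding cong_iff_dvd_diff by presburger

lemma not_cong_minus_mod_4:
  fixes a b :: int
  assumes "odd a" "[a = b] (mod 4)"
  shows "\<not> [a = - b] (mod 4)"
  using assms unfolding cong_iff_dvd_diff by presburger

lemma cong_mod_4_if_dvd_add:
  fixes c g k r :: int
  assumes "odd k" "[r = 3] (mod 4)" "4 dvd c + g * k * r"
  shows "[g = c * k] (mod 4)"
proof -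
  obtain p where p: "k = 2 * p + 1" using assms(1) by (elim oddE)
  obtain z where z: "r = 3 + 4 * z" using assms(2) by (metis cong_iff_lin cong_sym)
  obtain y where "c + g * k * r = 4 * y" using assms(3) by (elim dvdE)
  then have y: "c = 4 * y - g * k * r" by simp
  have "g - c * k = 4 * (- k * y + g * k ^ 2 * z + g * (1 + 3 * p + 3 * p ^ 2))"
    unfolding y z p by (simp add: algebra_simps power2_eq_square)
  then show ?thesis by (simp add: cong_iff_dvd_diff)
qed

lemma half_generator_correction_mod_4:
  fixes a b c g k r :: int
  assumes "even a" "even b" "odd c" "odd g" "odd k" "odd r" "[g = c * k] (mod 4)"
  shows "[a * (g * k * r) - a * b * g - g = (k - 1) + (a - 1) * c] (mod 4)"
proof -
  obtain p where p: "k = 2 * p + 1" using assms(5) by (elim oddE)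
  obtain d where d: "c = 2 * d + 1" using assms(3) by (elim oddE)
  obtain e where e: "a = 2 * e" using assms(1) by (elim evenE)
  obtain b' where b: "b = 2 * b'" using assms(2) by (elim evenE)
  obtain q where q: "g * k * r = 2 * q + 1" using assms(4,5,6) by (metis even_mult_iff oddE)
  obtain w where w: "g = c * k + 4 * w" using assms(7) by (metis cong_iff_lin cong_sym)
  have "a * (g * k * r) - a * b * g - g - ((k - 1) + (a - 1) * c)
      = 2 * e * (2 * q + 1 - c) - 4 * e * b' * g - (g - c + (k - 1))"
    unfolding q by (simp add: e b algebra_simps)
  also have "\<dots> = 4 * (e * (q - d) - e * b' * g - w - p * (d + 1))"
    using w by (simp add: p d algebra_simps)
  finally show ?thesis by (simp add: cong_iff_dvd_diff)
qed

lemma half_generator_exponent_cong: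
  fixes c g k r lam :: int and n N :: nat
  assumes N: "N \<ge> 3" and "n > 0" and odd: "odd c" "odd g" "odd k"
    and r: "[r = 3] (mod 4)"
    and char_eq: "[c + g * k * r = 2 ^ (N - 1) * lam] (mod 2 ^ N)"
  shows "[c + g * (1 + 2 ^ (N + n - 2)) * (k * r - 2 ^ (N - 2))
    = 2 ^ (N - 2) * (2 * lam + (k - 1) + (2 ^ n - 1) * c)] (mod 2 ^ N)"
proof -
  define P where "P = (2::int) ^ (N - 2)"
  have "even P" unfolding P_def using N by simp
  have "N - 1 = Suc (N - 2)" "N + n - 2 = n + (N - 2)" using N by auto
  then have powers: "2 ^ (N - 1) = 2 * P" "2 ^ (N + n - 2) = 2 ^ n * P"
    by (simp_all only: P_def power_add power_Suc)
  have "4 dvd c + g * k * r"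
  proof -
    have "[c + g * k * r = 2 * P * lam] (mod 2 ^ 2)"
      using char_eq unfolding powers by (rule cong_power_le) (use N in simp)
    then have "2 ^ 2 dvd c + g * k * r \<longleftrightarrow> 2 ^ 2 dvd 2 * P * lam" by (rule cong_dvd_iff)
    then show ?thesis using \<open>even P\<close> by (auto elim!: evenE)
  qed
  then have "[g = c * k] (mod 4)" by (rule cong_mod_4_if_dvd_add[OF odd(3) r])
  moreover have "odd r" using r unfolding cong_iff_dvd_diff by presburger
  ultimately have "[2 ^ n * (g * k * r) - 2 ^ n * P * g - g = (k - 1) + (2 ^ n - 1) * c] (mod 4)"
    using \<open>even P\<close> \<open>n > 0\<close> odd by (intro half_generator_correction_mod_4) simp_all
  then have correction: "[2 * lam + (2 ^ n * (g * k * r) - 2 ^ n * P * g - g)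
      = 2 * lam + ((k - 1) + (2 ^ n - 1) * c)] (mod 2 ^ 2)"
    by (intro cong_add cong_refl) simp
  have "c + g * (1 + 2 ^ (N + n - 2)) * (k * r - 2 ^ (N - 2))
      = (c + g * k * r) + P * (2 ^ n * (g * k * r) - 2 ^ n * P * g - g)"
    unfolding powers P_def[symmetric] by (simp add: algebra_simps)
  also have "[\<dots> = 2 * P * lam + P * (2 ^ n * (g * k * r) - 2 ^ n * P * g - g)] (mod 2 ^ N)"
    using char_eq unfolding powers by (intro cong_add cong_refl)
  also have "2 * P * lam + P * (2 ^ n * (g * k * r) - 2 ^ n * P * g - g)
      = P * (2 * lam + (2 ^ n * (g * k * r) - 2 ^ n * P * g - g))"
    by (simp add: algebra_simps)
  also have "[\<dots> = P * (2 * lam + ((k - 1) + (2 ^ n - 1) * c))] (mod 2 ^ N)"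
    unfolding P_def using N by (intro cong_power_mult[OF correction[unfolded P_def]]) simp
  finally show ?thesis by (simp only: P_def add.assoc)
qed

lemma odd_power_cong_iff:
  fixes x y :: int
  assumes "odd x" "odd y" "odd s"
  shows "[x ^ s = y ^ s] (mod 2 ^ l) \<longleftrightarrow> [x = y] (mod 2 ^ l)"
proof -
  define Q where "Q = (\<Sum>i<s. y ^ (s - Suc i) * x ^ i)"
  have "odd Q \<longleftrightarrow> odd (\<Sum>i<s. 1 :: int)"
    unfolding Q_def using assms(1,2) by (induction s) (simp_all add: even_sum_iff)
  then have "coprime (2 ^ l) Q" using assms(3) by simp
  moreover have "x ^ s - y ^ s = (x - y) * Q"
    unfolding Q_def by (rule power_diff_sumr2)
  ultimately show ?thesis
    by (simp add: cong_iff_dvd_diff coprime_dvd_mult_left_iff)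
qed

lemma square_cong_imp_cong:
  fixes x y :: int
  assumes "odd x" "[x = y] (mod 4)" "[x ^ 2 = y ^ 2] (mod 2 ^ Suc l)"
  shows "[x = y] (mod 2 ^ l)"
proof -
  obtain w where w: "x + y = 2 * w" "odd w"
  proof
    show "x + y = 2 * ((x + y) div 2)" "odd ((x + y) div 2)"
      using assms(1,2) unfolding cong_iff_dvd_diff by presburger+
  qed
  have "x ^ 2 - y ^ 2 = 2 * (w * (x - y))"
    using w(1) by (simp add: power2_eq_square square_diff_square_factored)
  then have "2 * 2 ^ l dvd 2 * (w * (x - y))"
    using assms(3) by (simp add: cong_iff_dvd_diff)
  then have "2 ^ l dvd w * (x - y)" by simp
  then show ?thesis
    using w(2) by (simp add: cong_iff_dvd_diff coprime_dvd_mult_right_iff)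
qed

lemma power_two_power_Suc: "x ^ 2 ^ Suc n = (x ^ 2 ^ n) ^ 2" for x :: "'a::monoid_mult"
  unfolding power_Suc2 by (rule power_mult)

lemma two_power_power_cong_imp_cong:
  fixes x y :: int
  assumes "odd x" "[x = y] (mod 4)" "[x ^ 2 ^ t = y ^ 2 ^ t] (mod 2 ^ l)"
  shows "[x = y] (mod 2 ^ (l - t))"
  using assms(3)
proof (induction t arbitrary: l)
  case (Suc t)
  show ?case
  proof (cases l)
    case l: (Suc l')
    have "odd (x ^ 2 ^ t)" using assms(1) by simp
    moreover have "[x ^ 2 ^ t = y ^ 2 ^ t] (mod 4)"
      by (rule cong_pow[OF assms(2)])
    moreover have "[(x ^ 2 ^ t) ^ 2 = (y ^ 2 ^ t) ^ 2] (mod 2 ^ Suc l')"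
      using Suc.prems by (simp only: l power_two_power_Suc)
    ultimately have "[x ^ 2 ^ t = y ^ 2 ^ t] (mod 2 ^ l')"
      by (rule square_cong_imp_cong)
    then show ?thesis using Suc.IH l by simp
  qed simp
qed simp

lemma equal_powers_cong:
  fixes x y :: int
  assumes "odd x" "odd y" "odd s" "[x ^ (2 ^ t * s) = y ^ (2 ^ t * s)] (mod 2 ^ l)"
  shows "[x = y] (mod 2 ^ (l - t)) \<or> t > 0 \<and> [x = - y] (mod 2 ^ (l - t))"
proof -
  have pow: "[x ^ 2 ^ t = y ^ 2 ^ t] (mod 2 ^ l)"
    using assms odd_power_cong_iff[of "x ^ 2 ^ t" "y ^ 2 ^ t" s] by (simp add: power_mult)
  have "[x = y] (mod 4) \<or> [x = - y] (mod 4)"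
    using assms(1,2) unfolding cong_iff_dvd_diff by presburger
  then consider "t = 0" | "[x = y] (mod 4)" | "t > 0" "[x = - y] (mod 4)" by blast
  then show ?thesis
  proof cases
    case 3
    then have "[x ^ 2 ^ t = (- y) ^ 2 ^ t] (mod 2 ^ l)" using pow by simp
    then show ?thesis using two_power_power_cong_imp_cong assms(1) 3 by blast
  qed (use pow two_power_power_cong_imp_cong assms(1) in auto)
qed

subsection \<open>Powers of 5 modulo powers of two\<close>

lemma two_power_dvd_5_power_minus_1:
  assumes "i \<ge> 2"
  shows "(2::int) ^ i dvd 5 ^ 2 ^ (i - 2) - 1"
  using assms
proof (induction i rule: dec_induct)
  case (step i)
  have "Suc i - 2 = Suc (i - 2)" using step.hyps by simp
  then have "(5::int) ^ 2 ^ (Suc i - 2) - 1 = (5 ^ 2 ^ (i - 2) + 1) * (5 ^ 2 ^ (i - 2) - 1)"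
    by (simp only: power_two_power_Suc) (simp add: power2_eq_square algebra_simps)
  then show ?case using step.IH by (simp add: mult_dvd_mono)
qed simp

lemma R_expansion:
  assumes "i \<ge> 2"
  shows "5 ^ 2 ^ (i - 2) = 1 + R i * 2 ^ i"
  using two_power_dvd_5_power_minus_1[OF assms] by (simp add: R_def)

lemma R_Suc:
  assumes "i \<ge> 2"
  shows "R (Suc i) = R i + R i ^ 2 * 2 ^ (i - 1)"
proof -
  have i: "i = Suc (i - 1)" "Suc i - 2 = Suc (i - 2)" using assms by auto
  have "1 + R (Suc i) * 2 ^ Suc i = (1 + R i * 2 ^ i) ^ 2"
    using R_expansion[of "Suc i"] assms
    by (simp only: i(2) power_two_power_Suc R_expansion[OF assms])
  also have "\<dots> = 1 + (R i + R i ^ 2 * 2 ^ (i - 1)) * 2 ^ Suc i"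
    by (subst (2 4) i(1)) (simp add: power2_eq_square algebra_simps)
  finally show ?thesis by simp
qed

lemma odd_R: "i \<ge> 2 \<Longrightarrow> odd (R i)"
proof (induction i rule: dec_induct)
  case base
  show ?case by (simp add: R_def)
next
  case (step i)
  then show ?case by (simp add: R_Suc)
qed

lemma R_Suc_cong:
  assumes "i \<ge> 2"
  shows "[R (Suc i) = R i + 2 ^ (i - 1)] (mod 2 ^ (i + 2))"
proof -
  obtain w where w: "R i = 2 * w + 1"
    using odd_R[OF assms] by (elim oddE)
  have "2 * 2 ^ 2 dvd (w * (w + 1)) * 2 ^ 2"
    by (intro mult_dvd_mono) simp_all
  then have "[R i ^ 2 = 1] (mod 2 ^ 3)"
    by (simp add: w cong_iff_dvd_diff power2_eq_square algebra_simps)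
  then have "[2 ^ (i - 1) * R i ^ 2 = 2 ^ (i - 1) * 1] (mod 2 ^ (i + 2))"
    using assms by (intro cong_power_mult[of _ _ 2 3]) auto
  then show ?thesis
    unfolding R_Suc[OF assms] by (intro cong_add cong_refl) (simp add: mult.commute)
qed

lemma R_mod_4: "i \<ge> 3 \<Longrightarrow> [R i = 3] (mod 4)"
proof (induction i rule: dec_induct)
  case base
  show ?case by (simp add: R_def cong_def)
next
  case (step i)
  have "[R (Suc i) = R i + 2 ^ (i - 1)] (mod 2 ^ 2)"
    using step.hyps by (intro cong_power_le[OF R_Suc_cong]) simp_all
  also have "[R i + 2 ^ (i - 1) = 3 + 0] (mod 2 ^ 2)"
  proof (rule cong_add)
    have "(2::int) ^ 2 dvd 2 ^ (i - 1)"
      using step.hyps by (intro le_imp_power_dvd) simp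
    then show "[2 ^ (i - 1) = (0::int)] (mod 2 ^ 2)" by (simp only: cong_0_iff)
  qed (use step.IH in simp)
  finally show ?case by simp
qed

lemma R_mult_inverse_R_Suc:
  assumes "i \<ge> 2" "[R (Suc i) * r = 1] (mod 2 ^ i)"
  shows "[R i * r * (1 + 2 ^ (i - 1)) = 1] (mod 2 ^ i)"
proof -
  have "2 ^ (i - 1) * 2 dvd 2 ^ (i - 1) * (R i * (1 - R i))"
    using odd_R[OF assms(1)] by (intro mult_dvd_mono) simp_all
  moreover have "2 ^ (i - 1) * 2 = (2::int) ^ i"
    using assms(1) by (simp flip: power_Suc2)
  ultimately have "[R i * (1 + 2 ^ (i - 1)) = R (Suc i)] (mod 2 ^ i)"
    by (simp add: R_Suc[OF assms(1)] cong_iff_dvd_diff power2_eq_square algebra_simps)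
  then have "[R i * (1 + 2 ^ (i - 1)) * r = R (Suc i) * r] (mod 2 ^ i)"
    by (rule cong_scalar_right)
  then have "[R i * (1 + 2 ^ (i - 1)) * r = 1] (mod 2 ^ i)"
    using assms(2) by (rule cong_trans)
  then show ?thesis by (simp only: mult_ac)
qed

lemma power_5_cong:
  assumes "i \<ge> 2"
  shows "[5 ^ (2 ^ (i - 2) * s) = 1 + 2 ^ i * (int s * R i)] (mod 2 ^ (2 * i))"
proof -
  have "(5::int) ^ (2 ^ (i - 2) * s) = (1 + R i * 2 ^ i) ^ s"
    by (simp add: power_mult R_expansion[OF assms])
  also have "[\<dots> = 1 + int s * (R i * 2 ^ i)] (mod 2 ^ (2 * i))"
    by (rule cong_dvd_modulus[OF one_plus_power_cong])
      (simp add: power_mult_distrib power_mult[symmetric] mult.commute)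
  finally show ?thesis by (simp add: mult_ac)
qed

lemma power_5_cong_1:
  assumes "i \<ge> 2"
  shows "[5 ^ (2 ^ (i - 2) * s) = (1::int)] (mod 2 ^ i)"
proof -
  have "[5 ^ (2 ^ (i - 2) * s) = 1 + 2 ^ i * (int s * R i)] (mod 2 ^ i)"
    using power_5_cong[OF assms] by (rule cong_power_le) simp
  then show ?thesis by (simp add: cong_def)
qed

text \<open>
  Splitting off the even part of \<open>s\<close> brings in \<open>R (Suc i)\<close>, which gains a factor 2 in the modulus over
  \<open>power_5_cong\<close> without a quadratic binomial term.
\<close>
lemma odd_power_5_cong:
  assumes "i \<ge> 2" "odd s"
  shows "[5 ^ (2 ^ (i - 2) * s) = 1 + 2 ^ i * (int s * R (Suc i) - 2 ^ (i - 1))] (mod 2 ^ (2 * i + 1))"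
proof -
  obtain p where p: "s = 2 * p + 1" using assms(2) by (elim oddE)
  have "2 ^ (i - 2) * s = 2 ^ Suc (i - 2) * p + 2 ^ (i - 2)"
    by (simp add: p)
  also have "Suc (i - 2) = Suc i - 2" using assms(1) by simp
  finally have "(5::int) ^ (2 ^ (i - 2) * s) = 5 ^ (2 ^ (Suc i - 2) * p) * (1 + R i * 2 ^ i)"
    by (simp only: power_add R_expansion[OF assms(1)])
  also have "[\<dots> = (1 + 2 ^ Suc i * (int p * R (Suc i))) * (1 + R i * 2 ^ i)] (mod 2 ^ (2 * i + 1))"
    by (intro cong_scalar_right cong_power_le[OF power_5_cong[of "Suc i" p]]) (use assms(1) in auto)
  also have "(1 + 2 ^ Suc i * (int p * R (Suc i))) * (1 + R i * 2 ^ i)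
      = 1 + 2 ^ i * (R i + 2 * int p * R (Suc i)) + 2 ^ (2 * i + 1) * (int p * R (Suc i) * R i)"
    by (simp only: power_add power_Suc mult_2 power_one_right) (simp add: algebra_simps)
  also have "[\<dots> = 1 + 2 ^ i * (R i + 2 * int p * R (Suc i))] (mod 2 ^ (2 * i + 1))"
    by (simp add: cong_def)
  also have "[1 + 2 ^ i * (R i + 2 * int p * R (Suc i))
      = 1 + 2 ^ i * (int s * R (Suc i) - 2 ^ (i - 1))] (mod 2 ^ (2 * i + 1))"
  proof (intro cong_add cong_refl cong_power_mult)
    have "[R i + 2 ^ (i - 1) + (2 * int p * R (Suc i) - 2 ^ (i - 1))
        = R (Suc i) + (2 * int p * R (Suc i) - 2 ^ (i - 1))] (mod 2 ^ (i + 2))"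
      by (intro cong_add cong_refl cong_sym[OF R_Suc_cong] assms)
    then show "[R i + 2 * int p * R (Suc i) = int s * R (Suc i) - 2 ^ (i - 1)] (mod 2 ^ (i + 2))"
      by (simp add: p algebra_simps)
  qed simp
  finally show ?thesis .
qed

lemma ord_5_two_power:
  assumes "m \<ge> 2"
  shows "ord (2 ^ m) (5::nat) = 2 ^ (m - 2)"
proof (cases "m = 2")
  case True
  then show ?thesis using ord_eq_Suc_0_iff[of 4 5] by (simp add: cong_def)
next
  case False
  then show ?thesis using assms by (intro ord_twopow_3_5) auto
qed

lemma power_5_cong_iff:
  assumes "m \<ge> 2"
  shows "[(5::int) ^ a = 5 ^ b] (mod 2 ^ m) \<longleftrightarrow> [a = b] (mod 2 ^ (m - 2))"
proof -
  have "[(5::int) ^ a = 5 ^ b] (mod 2 ^ m) \<longleftrightarrow> [(5::nat) ^ a = 5 ^ b] (mod 2 ^ m)"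
    using cong_int_iff[of "5 ^ a" "5 ^ b" "2 ^ m"] by simp
  also have "\<dots> \<longleftrightarrow> [a = b] (mod 2 ^ (m - 2))"
    using order_divides_expdiff[of "2 ^ m" 5 a b] ord_5_two_power[OF assms] by simp
  finally show ?thesis .
qed

lemma power_5_not_cong_1:
  assumes "i \<ge> 2"
  shows "\<not> [5 ^ 2 ^ (i - 2) = (1::int)] (mod 2 ^ Suc i)"
proof -
  have "Suc i - 2 = Suc (i - 2)" using assms by simp
  then have "[5 ^ 2 ^ (i - 2) = (1::int)] (mod 2 ^ Suc i) \<longleftrightarrow> (2::nat) ^ Suc (i - 2) dvd 2 ^ (i - 2)"
    using power_5_cong_iff[of "Suc i" "2 ^ (i - 2)" 0] assms by (simp add: cong_0_iff del: power_Suc)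
  then show ?thesis using power_dvd_imp_le[of 2 "Suc (i - 2)" "i - 2"] by auto
qed

lemma cong_power_two_Suc_cases:
  fixes x z :: int
  assumes "i \<ge> 2" "odd z" "[x = z] (mod 2 ^ i)"
  shows "[x = z] (mod 2 ^ Suc i) \<or> [x = z * 5 ^ 2 ^ (i - 2)] (mod 2 ^ Suc i)"
proof -
  obtain w where w: "x - z = 2 ^ i * w"
    using assms(3) unfolding cong_iff_dvd_diff by (elim dvdE)
  have "x - z * 5 ^ 2 ^ (i - 2) = 2 ^ i * (w - z * R i)"
    using w by (simp add: R_expansion[OF assms(1)] algebra_simps)
  moreover have "even w \<or> even (w - z * R i)"
    using assms(2) odd_R[OF assms(1)] by simp
  ultimately show ?thesis
    using w by (auto simp: cong_iff_dvd_diff power_Suc2 simp del: power_Suc)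
qed

lemma cong_imp_cong_mult_power_5:
  fixes a x :: int
  assumes "2 \<le> j" "j \<le> m" "odd a" "[x = a] (mod 2 ^ j)"
  shows "\<exists>s<2 ^ (m - j). [x = a * 5 ^ (2 ^ (j - 2) * s)] (mod 2 ^ m)"
  using assms(2)
proof (induction m rule: dec_induct)
  case base
  show ?case using assms(4) by (intro exI[of _ 0]) simp
next
  case (step m)
  then obtain s where s: "s < 2 ^ (m - j)" "[x = a * 5 ^ (2 ^ (j - 2) * s)] (mod 2 ^ m)"
    by blast
  have exp: "2 ^ (j - 2) * s + 2 ^ (m - 2) = 2 ^ (j - 2) * (s + 2 ^ (m - j))"
    using assms(1) step.hyps(1) by (simp add: distrib_left power_add[symmetric])
  have "Suc m - j = Suc (m - j)" using step.hyps by simp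
  then have lt: "s < 2 ^ (Suc m - j)" "s + 2 ^ (m - j) < 2 ^ (Suc m - j)" using s(1) by simp_all
  have "[x = a * 5 ^ (2 ^ (j - 2) * s)] (mod 2 ^ Suc m)
      \<or> [x = a * 5 ^ (2 ^ (j - 2) * (s + 2 ^ (m - j)))] (mod 2 ^ Suc m)"
    using cong_power_two_Suc_cases[OF _ _ s(2)] assms(1,3) step.hyps(1)
    unfolding exp[symmetric] by (simp add: power_add mult.assoc)
  then show ?case using lt by blast
qed

lemma bij_betw_power_5_residue_class:
  fixes a :: int
  assumes "2 \<le> j" "j \<le> m" "odd a"
  shows "bij_betw (\<lambda>s. a * 5 ^ (2 ^ (j - 2) * s) mod 2 ^ m) {..<2 ^ (m - j)}
           {x \<in> {0..<2 ^ m}. [x = a] (mod 2 ^ j)}" (is "bij_betw ?g ?I ?X")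
proof (rule bij_betw_imageI)
  show "inj_on ?g ?I"
  proof (rule inj_onI)
    fix s s' assume "s \<in> ?I" "s' \<in> ?I" "?g s = ?g s'"
    moreover from \<open>?g s = ?g s'\<close>
    have "[5 ^ (2 ^ (j - 2) * s) = (5::int) ^ (2 ^ (j - 2) * s')] (mod 2 ^ m)"
      using assms(3) by (simp add: cong_def[symmetric] cong_mult_lcancel)
    then have "[2 ^ (j - 2) * s = 2 ^ (j - 2) * s'] (mod 2 ^ (j - 2) * 2 ^ (m - j))"
      using assms(1,2) by (simp add: power_5_cong_iff power_add[symmetric])
    then have "[s = s'] (mod 2 ^ (m - j))"
      by (simp add: cong_def mult_mod_right[symmetric])
    ultimately show "s = s'" by (simp add: cong_def)
  qed
  show "?g ` ?I = ?X"
  proof (intro equalityI subsetI)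
    fix x assume "x \<in> ?g ` ?I"
    then obtain s where x: "x = ?g s" by blast
    have "[x = a * 5 ^ (2 ^ (j - 2) * s)] (mod 2 ^ m)"
      unfolding x by (simp only: cong_def mod_mod_trivial)
    then have "[x = a * 5 ^ (2 ^ (j - 2) * s)] (mod 2 ^ j)"
      using assms(2) by (rule cong_power_le)
    also have "[a * 5 ^ (2 ^ (j - 2) * s) = a * 1] (mod 2 ^ j)"
      by (intro cong_scalar_left power_5_cong_1 assms)
    finally show "x \<in> ?X" by (simp add: x)
  next
    fix x assume "x \<in> ?X"
    then obtain s where "s \<in> ?I" "[x = a * 5 ^ (2 ^ (j - 2) * s)] (mod 2 ^ m)" "x mod 2 ^ m = x"
      using cong_imp_cong_mult_power_5[OF assms, of x] by auto
    then show "x \<in> ?g ` ?I" by (auto simp: cong_def)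
  qed
qed

subsection \<open>Characters modulo powers of two\<close>

lemma dchar_mult: "dchar q chi \<Longrightarrow> chi (x * y) = chi x * chi y"
  by (simp add: dchar_def)

lemma dchar_1: "dchar q chi \<Longrightarrow> chi 1 = 1"
  by (simp add: dchar_def)

lemma dchar_power: "dchar q chi \<Longrightarrow> chi (x ^ s) = chi x ^ s"
  by (induction s) (simp_all add: dchar_mult dchar_1)

lemma dchar_cong:
  assumes "dchar q chi" "[x = y] (mod q)"
  shows "chi x = chi y"
proof -
  interpret periodic_fun_simple chi "of_int q"
    by standard (use assms(1) in \<open>simp add: dchar_def\<close>)
  obtain l where "x = y + l * q"
    using assms(2) by (metis cong_iff_lin cong_sym mult.commute)
  then show ?thesis using plus_of_int[of y l] by simp
qed

lemma dchar_even: "dchar (2 ^ m) chi \<Longrightarrow> m > 0 \<Longrightarrow> even x \<Longrightarrow> chi x = 0"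
  by (simp add: dchar_def)

lemma dchar_minus_1:
  assumes "dchar q chi"
  shows "chi (- 1) = 1 \<or> chi (- 1) = - 1"
proof -
  have "chi (- 1) ^ 2 = 1"
    using dchar_mult[OF assms, of "-1" "-1"] dchar_1[OF assms] by (simp add: power2_eq_square)
  then show ?thesis by (simp add: power2_eq_1_iff)
qed

lemma dchar_two_power_eqI:
  assumes chi: "dchar (2 ^ m) chi" and chi': "dchar (2 ^ m) chi'" and m: "m \<ge> 2"
    and eq: "chi 5 = chi' 5" "chi (- 1) = chi' (- 1)"
  shows "chi = chi'"
proof
  fix x
  show "chi x = chi' x"
  proof (cases "even x")
    case True
    then show ?thesis using dchar_even[OF chi] dchar_even[OF chi'] m by simp
  next
    case False
    then obtain a where a: "a = 1 \<or> a = - 1" "[x = a] (mod 2 ^ 2)"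
      using cong_mod_4_odd_cases[of x] by auto
    then obtain s where "[x = a * 5 ^ s] (mod 2 ^ m)"
      using cong_imp_cong_mult_power_5[of 2 m a x] m by auto
    then have "chi x = chi a * chi 5 ^ s" "chi' x = chi' a * chi' 5 ^ s"
      using chi chi' by (simp_all add: dchar_cong dchar_mult dchar_power)
    then show ?thesis using a(1) eq dchar_1[OF chi] dchar_1[OF chi'] by auto
  qed
qed

lemma dchar_chi0_2:
  assumes "m > 0"
  shows "dchar (2 ^ m) chi0_2"
  using assms by (auto simp: dchar_def chi0_2_def)

lemma dchar_chi4:
  assumes "m \<ge> 2"
  shows "dchar (2 ^ m) chi4"
proof -
  have "(4::int) dvd 2 ^ m" using le_imp_power_dvd[OF assms, of "2::int"] by simp
  then have "(x + 2 ^ m) mod 4 = x mod 4" for x :: int by (auto elim!: dvdE)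
  moreover have "chi4 (x * y) = chi4 x * chi4 y" for x y
  proof -
    have "(x * y) mod 4 = 1 \<longleftrightarrow> (x mod 4 = 1 \<longleftrightarrow> y mod 4 = 1)" if "odd x" "odd y"
    proof -
      have "x mod 4 = 1 \<or> x mod 4 = 3" "y mod 4 = 1 \<or> y mod 4 = 3"
        using that by presburger+
      then show ?thesis by (subst mod_mult_eq[symmetric]) auto
    qed
    then show ?thesis by (auto simp: chi4_def)
  qed
  ultimately show ?thesis using assms by (simp add: dchar_def chi4_def)
qed

lemma dchar_trivial_at_5_iff:
  assumes "dchar (2 ^ m) chi" "m \<ge> 2" "chi 5 = 1"
  shows "chi = chi0_2 \<longleftrightarrow> chi (- 1) = 1" "chi = chi4 \<longleftrightarrow> chi (- 1) = - 1"
proof -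
  have "chi0_2 5 = 1" "chi0_2 (- 1) = 1" "chi4 5 = 1" "chi4 (- 1) = - 1"
    by (simp_all add: chi0_2_def chi4_def)
  then show "chi = chi0_2 \<longleftrightarrow> chi (- 1) = 1" "chi = chi4 \<longleftrightarrow> chi (- 1) = - 1"
    using dchar_two_power_eqI[OF assms(1) dchar_chi0_2] dchar_two_power_eqI[OF assms(1) dchar_chi4]
      assms(2,3) by auto
qed

lemma dchar_5_power:
  assumes "dchar (2 ^ m) chi" "chi 5 = eq (2 ^ (m - 2)) c" "2 \<le> i" "i \<le> m"
  shows "chi (5 ^ (2 ^ (i - 2) * s)) = eq (2 ^ (m - i)) (int s * c)"
proof -
  have "chi (5 ^ (2 ^ (i - 2) * s)) = eq (2 ^ (m - 2)) (2 ^ (i - 2) * (int s * c))"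
    using assms by (simp add: dchar_power eq_power mult_ac)
  also have "m - 2 = (i - 2) + (m - i)" using assms(3,4) by simp
  finally show ?thesis by (simp only: eq_power_two_cancel)
qed

text \<open>
  When \<open>m \<le> 2 * i\<close>, the units congruent to 1 modulo \<open>2 ^ i\<close> multiply like the residues modulo
  \<open>2 ^ (m - i)\<close> add.
\<close>
lemma dchar_shift:
  assumes chi: "dchar (2 ^ m) chi" "chi 5 = eq (2 ^ (m - 2)) c"
    and i: "2 \<le> i" "i \<le> m" "m \<le> 2 * i"
    and g: "[g * R i * v = z] (mod 2 ^ (m - i))"
  shows "chi (v + 2 ^ i * z) = chi v * eq (2 ^ (m - i)) (c * g)"
proof -
  define s where "s = nat (g mod 2 ^ (m - i))"
  have s: "[int s = g] (mod 2 ^ (m - i))" by (simp add: s_def cong_def)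
  have "[v * 5 ^ (2 ^ (i - 2) * s) = v * (1 + 2 ^ i * (int s * R i))] (mod 2 ^ m)"
    using i by (intro cong_scalar_left cong_power_le[OF power_5_cong])
  also have "v * (1 + 2 ^ i * (int s * R i)) = v + 2 ^ i * (int s * R i * v)"
    by (simp add: algebra_simps)
  also have "[\<dots> = v + 2 ^ i * z] (mod 2 ^ m)"
  proof (intro cong_add cong_refl cong_power_mult)
    have "[int s * R i * v = g * R i * v] (mod 2 ^ (m - i))"
      by (intro cong_scalar_right s)
    then show "[int s * R i * v = z] (mod 2 ^ (m - i))" using g by (rule cong_trans)
  qed simp
  finally have "chi (v + 2 ^ i * z) = chi (v * 5 ^ (2 ^ (i - 2) * s))"
    by (intro dchar_cong[OF chi(1)]) (rule cong_sym)
  also have "\<dots> = chi v * eq (2 ^ (m - i)) (int s * c)"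
    by (simp only: dchar_mult[OF chi(1)] dchar_5_power[OF chi i(1,2)])
  also have "eq (2 ^ (m - i)) (int s * c) = eq (2 ^ (m - i)) (c * g)"
    unfolding mult.commute[of _ c] by (intro eq_cong cong_scalar_left s) simp
  finally show ?thesis .
qed

lemma dchar_shift_half_modulus:
  assumes "dchar (2 ^ m) chi" "chi 5 = eq (2 ^ (m - 2)) c" "m \<ge> 3" "odd v"
  shows "chi (v + 2 ^ (m - 1) * z) = chi v * eq 2 (c * z)"
proof -
  have "odd (R (m - 1))" using assms(3) by (intro odd_R) simp
  then have "[z * R (m - 1) * v = z] (mod 2)"
    using assms(4) by (simp add: cong_def mod2_eq_if)
  then have "[z * R (m - 1) * v = z] (mod 2 ^ (m - (m - 1)))"
    using assms(3) by simp
  from dchar_shift[OF assms(1,2) _ _ _ this] show ?thesis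
    using assms(3) by simp
qed

lemma primitive_dchar_exponent_odd:
  assumes "m \<ge> 3" "primitive_dchar (2 ^ m) chi" "chi 5 = eq (2 ^ (m - 2)) c"
  shows "odd c"
proof
  assume "even c"
  have chi: "dchar (2 ^ m) chi" using assms(2) by (simp add: primitive_dchar_def)
  have "(2::int) ^ (m - 1) < 2 ^ m" "(2::int) ^ (m - 1) dvd 2 ^ m"
    using assms(1) by (auto simp: le_imp_power_dvd)
  then obtain x where x: "[x = 1] (mod 2 ^ (m - 1))" "chi x \<noteq> 1"
    using assms(2) unfolding primitive_dchar_def by (metis zero_less_numeral zero_less_power)
  then obtain z where "x = 1 + 2 ^ (m - 1) * z"
    by (metis cong_iff_lin cong_sym)
  then have "chi x = chi 1 * eq 2 (c * z)"
    using dchar_shift_half_modulus[OF chi assms(3,1)] by simp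
  also have "\<dots> = 1"
    using \<open>even c\<close> by (simp add: dchar_1[OF chi] eq_eq_1_iff)
  finally show False using x(2) by simp
qed

subsection \<open>The Jacobi symbol of 2\<close>

definition kronecker_two :: "int \<Rightarrow> int" where
  "kronecker_two x = (if x mod 8 \<in> {1, 7} then 1 else - 1)"

lemma odd_mod_8: "odd x \<Longrightarrow> x mod 8 \<in> {1, 3, 5, 7}" for x :: int
  by (simp, presburger)

lemma kronecker_two_1 [simp]: "kronecker_two 1 = 1"
  by (simp add: kronecker_two_def)

lemma kronecker_two_mult:
  assumes "odd x" "odd y"
  shows "kronecker_two (x * y) = kronecker_two x * kronecker_two y"
  using odd_mod_8[OF assms(1)] odd_mod_8[OF assms(2)]
  unfolding kronecker_two_def by (subst mod_mult_eq[symmetric]) (elim insertE emptyE, simp_all)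

lemma kronecker_two_power: "odd x \<Longrightarrow> kronecker_two (x ^ s) = kronecker_two x ^ s"
  by (induction s) (simp_all add: kronecker_two_mult)

lemma kronecker_two_prod:
  "(\<And>p. p \<in> P \<Longrightarrow> odd (f p)) \<Longrightarrow> kronecker_two (\<Prod>p\<in>P. f p) = (\<Prod>p\<in>P. kronecker_two (f p))"
proof (induction P rule: infinite_finite_induct)
  case (insert p P)
  then have "odd (\<Prod>p\<in>P. f p)" by (auto simp: even_prod_iff)
  then show ?case using insert by (simp add: kronecker_two_mult)
qed simp_all

lemma kronecker_two_abs: "kronecker_two \<bar>x\<bar> = kronecker_two x"
proof -
  have "- x mod 8 \<in> {1, 7} \<longleftrightarrow> x mod 8 \<in> {1, 7}" by (simp, presburger)
  then show ?thesis unfolding kronecker_two_def abs_if by (cases "x < 0") (simp_all only: if_True if_False)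
qed

lemma Legendre_2:
  assumes "prime p" "p > 2"
  shows "Legendre 2 (int p) = kronecker_two (int p)"
proof -
  have "\<not> p dvd 2" using assms(2) by (auto dest: dvd_imp_le)
  then have "\<not> int p dvd 2" by (metis of_nat_dvd_iff of_nat_numeral)
  then interpret GAUSS p 2
    using assms by unfold_locales (auto simp: cong_0_iff)
  define h where "h = (int p - 1) div 2"
  have p: "int p = 2 * h + 1" using p_eq2 by (simp add: h_def)
  have C: "C = (\<lambda>x. 2 * x) ` {0<..h}"
    unfolding C_def B_def A_def image_image h_def[symmetric]
    by (intro image_cong) (auto simp: p mult.commute)
  have "E = (\<lambda>x. 2 * x) ` {h div 2<..h}"
    unfolding E_def C h_def[symmetric] using p assms(2) by (auto simp: image_iff)
  then have "card E = nat (h - h div 2)"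
    by (simp add: card_image inj_on_def)
  moreover have "even (nat (h - h div 2)) \<longleftrightarrow> int p mod 8 \<in> {1, 7}"
  proof -
    have "h \<ge> 0" using p by linarith
    then have "even (nat (h - h div 2)) \<longleftrightarrow> even (h - h div 2)" by (simp add: even_nat_iff)
    also have "\<dots> \<longleftrightarrow> int p mod 8 = 1 \<or> int p mod 8 = 7" unfolding p by presburger
    finally show ?thesis by simp
  qed
  ultimately show ?thesis using gauss_lemma by (auto simp: kronecker_two_def)
qed

lemma jacobi_2:
  assumes "odd h"
  shows "jacobi 2 h = kronecker_two h"
proof -
  define b where "b = nat \<bar>h\<bar>"
  have b: "odd b" "b > 0" "int b = \<bar>h\<bar>" using assms by (auto simp: b_def even_nat_iff)
  have prime: "prime p" "p > 2" "odd p" if "p \<in> prime_factors b" for p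
  proof -
    show "prime p" using that by auto
    have "p dvd b" using that by auto
    then show "odd p" using b(1) by (meson dvd_trans)
    then show "p > 2" using prime_ge_2_nat[OF \<open>prime p\<close>] by (cases "p = 2") auto
  qed
  have "jacobi 2 h = (\<Prod>p\<in>prime_factors b. kronecker_two (int p ^ multiplicity p b))"
    unfolding jacobi_def b_def[symmetric]
    by (intro prod.cong refl) (simp add: prime Legendre_2 kronecker_two_power)
  also have "\<dots> = kronecker_two (\<Prod>p\<in>prime_factors b. int p ^ multiplicity p b)"
    using prime(3) by (intro kronecker_two_prod[symmetric]) simp
  also have "(\<Prod>p\<in>prime_factors b. int p ^ multiplicity p b) = int b"
    using prime_factorization_nat[OF b(2)] by (metis (no_types, lifting) of_nat_power of_nat_prod prod.cong)
  finally show ?thesis by (simp add: b(3) kronecker_two_abs)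
qed

lemma cos_odd_mult_pi_quarter:
  assumes "odd h"
  shows "cos (pi / 4 * of_int h) = sqrt 2 / 2 * of_int (kronecker_two h)"
proof -
  define q r where "q = h div 8" and "r = h mod 8"
  have "h = 8 * q + r" by (simp add: q_def r_def)
  then have "pi / 4 * of_int h = 2 * pi * of_int q + pi / 4 * of_int r"
    by (simp add: algebra_simps)
  then have "cos (pi / 4 * of_int h) = cos (pi / 4 * of_int r)"
    by (simp only: cos_add cos_int_2pin sin_int_2pin mult_1 mult_zero_left diff_zero)
  moreover have "cos (pi / 4 * 3) = - (sqrt 2 / 2)"
    using cos_pi_minus[of "pi / 4"] by (simp add: cos_45 algebra_simps)
  moreover have "cos (pi / 4 * 5) = - (sqrt 2 / 2)"
    using cos_periodic_pi[of "pi / 4"] by (simp add: cos_45 algebra_simps)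
  moreover have "cos (pi / 4 * 7) = sqrt 2 / 2"
    using cos_2pi_minus[of "pi / 4"] by (simp add: cos_45 algebra_simps)
  ultimately show ?thesis
    using odd_mod_8[OF assms] unfolding kronecker_two_def r_def by (auto simp: cos_45)
qed

text \<open>This is \<open>1 + \<i>\<^sup>h = 2 cos (\<pi>h/4) \<omega>\<^sup>h\<close> with \<open>\<omega> = e\<^bsup>\<pi>\<i>/4\<^esup>\<close>.\<close>
lemma one_plus_eq_4:
  assumes "odd h"
  shows "1 + eq 4 h = of_real (sqrt 2) * (exp (\<i> * of_real pi / 4) powi h * of_int (jacobi 2 h))"
proof -
  define \<theta> where "\<theta> = pi / 4 * of_int h"
  have "exp (\<i> * of_real pi / 4) powi h = cis (pi / 4) powi h"
    by (simp add: cis_conv_exp)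
  also have "\<dots> = cis \<theta>"
    by (simp add: cis_power_int \<theta>_def mult.commute)
  finally have omega: "exp (\<i> * of_real pi / 4) powi h = cis \<theta>" .
  have "1 + eq 4 h = cis \<theta> * (cis (- \<theta>) + cis \<theta>)"
    by (simp add: eq_conv_cis cis_mult distrib_left \<theta>_def)
  also have "cis (- \<theta>) + cis \<theta> = of_real (2 * cos \<theta>)"
    by (simp add: complex_eq_iff)
  also have "2 * cos \<theta> = sqrt 2 * of_int (jacobi 2 h)"
    by (simp only: \<theta>_def cos_odd_mult_pi_quarter[OF assms] jacobi_2[OF assms])
  finally show ?thesis by (simp add: omega mult_ac)
qed

lemma two_powr_half_add:
  "2 powr (real a / 2 + real b) = 2 ^ (a div 2 + b) * (if even a then 1 else sqrt 2)"
proof -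
  have "real a / 2 = real (a div 2) + (if even a then 0 else 1 / 2)"
    by (auto elim!: evenE oddE simp: field_simps)
  then have "real a / 2 + real b = real (a div 2 + b) + (if even a then 0 else 1 / 2)"
    by simp
  then have "2 powr (real a / 2 + real b) = 2 ^ (a div 2 + b) * 2 powr (if even a then 0 else 1 / 2)"
    by (simp only: powr_add powr_realpow zero_less_numeral)
  then show ?thesis by (simp add: powr_half_sqrt)
qed

subsection \<open>Sums over residue classes\<close>

lemma sum_int_1_atMost_eq_0_lessThan:
  fixes f :: "int \<Rightarrow> 'a::comm_monoid_add"
  assumes "q > 0" "f q = f 0"
  shows "(\<Sum>x\<in>{1..q}. f x) = (\<Sum>x\<in>{0..<q}. f x)"
proof -
  have "{1..q} = insert q {1..<q}" "{0..<q} = insert 0 {1..<q}" using assms(1) by auto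
  then show ?thesis using assms(2) by simp
qed

lemma sum_residue_classes:
  fixes f :: "int \<Rightarrow> 'a::comm_monoid_add"
  assumes "q > 0"
  shows "(\<Sum>x\<in>{0..<M}. f x) = (\<Sum>a\<in>{0..<q}. \<Sum>x\<in>{x \<in> {0..<M}. [x = a] (mod q)}. f x)"
proof -
  have "(\<Sum>x\<in>{0..<M}. f x) = (\<Sum>a\<in>{0..<q}. \<Sum>x\<in>{x \<in> {0..<M}. x mod q = a}. f x)"
    using assms by (intro sum.group[symmetric]) auto
  also have "\<dots> = (\<Sum>a\<in>{0..<q}. \<Sum>x\<in>{x \<in> {0..<M}. [x = a] (mod q)}. f x)"
    by (intro sum.cong) (auto simp: cong_def)
  finally show ?thesis .
qed

lemma inj_on_mod_Un_uminus:
  fixes q :: int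
  assumes inj: "inj_on (\<lambda>x. x mod q) X"
    and not_cong: "\<And>x y. x \<in> X \<Longrightarrow> y \<in> X \<Longrightarrow> \<not> [x = - y] (mod q)"
  shows "inj_on (\<lambda>x. x mod q) (X \<union> uminus ` X)" "X \<inter> uminus ` X = {}"
proof -
  have "inj_on (\<lambda>x. x mod q) (uminus ` X)"
    using inj by (simp add: inj_on_def cong_def[symmetric] cong_minus_minus_iff)
  then show "inj_on (\<lambda>x. x mod q) (X \<union> uminus ` X)"
    using inj not_cong by (auto simp: inj_on_Un cong_def)
  have "x \<noteq> - y" if "x \<in> X" "y \<in> X" for x y
    using not_cong[OF that] by auto
  then show "X \<inter> uminus ` X = {}" by blast
qed

lemma sum_class_representatives:
  fixes g :: "int \<Rightarrow> 'a::comm_monoid_add"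
  assumes "q > 0" "inj_on (\<lambda>x. x mod q) X"
    and cong: "\<And>a b. [a = b] (mod q) \<Longrightarrow> g a = g b"
    and cover: "\<And>a. g a \<noteq> 0 \<Longrightarrow> \<exists>x\<in>X. [a = x] (mod q)"
  shows "(\<Sum>a\<in>{0..<q}. g a) = (\<Sum>x\<in>X. g x)"
proof -
  have "(\<Sum>a\<in>{0..<q}. g a) = (\<Sum>a\<in>(\<lambda>x. x mod q) ` X. g a)"
  proof (rule sum.mono_neutral_right)
    show "(\<lambda>x. x mod q) ` X \<subseteq> {0..<q}" using assms(1) by auto
    show "\<forall>a\<in>{0..<q} - (\<lambda>x. x mod q) ` X. g a = 0"
    proof (intro ballI, rule ccontr)
      fix a assume a: "a \<in> {0..<q} - (\<lambda>x. x mod q) ` X" "g a \<noteq> 0"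
      then obtain x where "x \<in> X" "a mod q = x mod q" using cover unfolding cong_def by blast
      then show False using a(1) by auto
    qed
  qed simp
  also have "\<dots> = (\<Sum>x\<in>X. g (x mod q))"
    by (simp add: sum.reindex assms(2))
  also have "\<dots> = (\<Sum>x\<in>X. g x)"
    by (intro sum.cong refl cong) (simp add: cong_def)
  finally show ?thesis .
qed

subsection \<open>The character sum\<close>

text \<open>
  The bounds on \<open>N\<close> are all that is used of its definition, which lets the class sums be evaluated in
  all four cases at once.
\<close>
locale two_power_sum =
  fixes m n t k k1 N :: nat and A A1 B c1 c2 Rinv :: int and chi1 chi2 :: "int \<Rightarrow> complex"
  assumes chi1: "dchar (2 ^ m) chi1" and chi1_5: "chi1 5 = eq (2 ^ (m - 2)) c1"
    and chi2: "dchar (2 ^ m) chi2" and chi2_5: "chi2 5 = eq (2 ^ (m - 2)) c2"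
    and A_eq: "A = 2 ^ n * A1" and k_eq: "k = 2 ^ t * k1" and n_pos: "n > 0"
    and odd_A1: "odd A1" and odd_k1: "odd k1" and odd_B: "odd B" and odd_c2: "odd c2"
    and N_ge: "t + 2 \<le> N" and N_le: "N + n \<le> m" and m_le: "m \<le> 2 * N + n"
    and Rinv: "[R (N + n) * Rinv = 1] (mod 2 ^ m)"
begin

definition argument :: "int \<Rightarrow> int" where
  "argument x = A * x ^ k + B"

definition f :: "int \<Rightarrow> complex" where
  "f x = chi1 x * chi2 (argument x)"

definition S :: complex where
  "S = (\<Sum>x\<in>{1..2 ^ m}. f x)"

definition C :: "int \<Rightarrow> int" where
  "C x = c1 * argument x + c2 * A * int k * x ^ k * R N * Rinv"

abbreviation level :: nat where
  "level \<equiv> N - t"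

definition solution :: "int \<Rightarrow> bool" where
  "solution x \<longleftrightarrow> odd x \<and> 2 ^ (m - level) dvd C x"

definition class_sum :: "int \<Rightarrow> complex" where
  "class_sum a = (\<Sum>x\<in>{x \<in> {0..<2 ^ m}. [x = a] (mod 2 ^ level)}. f x)"

text \<open>
  A logarithmic derivative: replacing \<open>x ^ k\<close> by \<open>x ^ k * (1 + 2 ^ N * p)\<close> multiplies
  \<open>chi2 (A * x ^ k + B)\<close> by the \<open>2 ^ (m - (N + n))\<close>-th root of unity of exponent \<open>slope x * p\<close>.
\<close>
definition slope :: "int \<Rightarrow> int" where
  "slope x = c2 * A1 * x ^ k * modular_inverse (2 ^ m) (argument x) * Rinv"

definition frequency :: "int \<Rightarrow> int" where
  "frequency x = c1 + 2 ^ (n + t) * (slope x * int k1 * R N)"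

lemma m_ge_3: "m \<ge> 3"
  using n_pos N_ge N_le by simp

lemma level_bounds: "2 \<le> level" "level \<le> m"
  using N_ge N_le by auto

lemma modulus_level: "m - level = (n + t) + (m - (N + n))"
  using N_ge N_le by simp

lemma argument_eq: "argument x = 2 ^ n * A1 * x ^ k + B"
  unfolding argument_def by (simp add: A_eq)

lemma odd_argument: "odd (argument x)"
  unfolding argument_eq using n_pos odd_B by simp

lemma odd_Rinv: "odd Rinv"
proof -
  have "[R (N + n) * Rinv = 1] (mod 2 ^ 1)"
    using m_ge_3 by (intro cong_power_le[OF Rinv]) simp
  then show ?thesis by (auto simp: cong_def)
qed

lemma argument_inverse: "[argument x * modular_inverse (2 ^ m) (argument x) = 1] (mod 2 ^ m)"
  using odd_argument[of x] by (intro cong_modular_inverse1) simp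

lemma odd_slope: "odd x \<Longrightarrow> odd (slope x)"
  using odd_c2 odd_A1 odd_Rinv coprime_modular_inverse[of "argument x" "2 ^ m"] odd_argument[of x] m_ge_3
  by (simp add: slope_def)

lemma C_eq: "C x = c1 * argument x + 2 ^ (n + t) * (c2 * A1 * int k1 * x ^ k * R N * Rinv)"
  unfolding C_def by (simp add: A_eq k_eq power_add)

lemma C_cong_frequency: "[C x = argument x * frequency x] (mod 2 ^ m)"
proof -
  have "[c1 * argument x + 2 ^ (n + t) * (c2 * A1 * int k1 * x ^ k * R N * Rinv) * 1
      = c1 * argument x + 2 ^ (n + t) * (c2 * A1 * int k1 * x ^ k * R N * Rinv)
        * (argument x * modular_inverse (2 ^ m) (argument x))] (mod 2 ^ m)"
    by (intro cong_add cong_scalar_left cong_refl cong_sym[OF argument_inverse])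
  then show ?thesis by (simp add: C_eq frequency_def slope_def algebra_simps)
qed

lemma solution_iff_dvd_frequency: "solution x \<longleftrightarrow> odd x \<and> 2 ^ (m - level) dvd frequency x"
proof -
  have "2 ^ (m - level) dvd C x \<longleftrightarrow> 2 ^ (m - level) dvd argument x * frequency x"
    by (intro cong_dvd_iff cong_power_le[OF C_cong_frequency]) simp
  then show ?thesis using odd_argument[of x] by (simp add: solution_def coprime_dvd_mult_right_iff)
qed

lemma f_cong:
  assumes "[x = y] (mod 2 ^ m)"
  shows "f x = f y"
proof -
  have "[argument x = argument y] (mod 2 ^ m)"
    unfolding argument_def using assms by (intro cong_add cong_scalar_left cong_pow cong_refl)
  then show ?thesis
    using assms unfolding f_def by (metis dchar_cong[OF chi1] dchar_cong[OF chi2])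
qed

lemma f_even: "even x \<Longrightarrow> f x = 0"
  using dchar_even[OF chi1] m_ge_3 by (simp add: f_def)

lemma f_minus: "even k \<Longrightarrow> f (- x) = chi1 (- 1) * f x"
  using dchar_mult[OF chi1, of "-1" x] by (simp add: f_def argument_def)

lemma solution_minus: "even k \<Longrightarrow> solution (- x) \<longleftrightarrow> solution x"
  by (simp add: solution_def C_def argument_def)

lemma argument_mult_power_5_cong:
  assumes "t + 2 \<le> L" and power: "[5 ^ (2 ^ (L - 2) * (k1 * s)) = 1 + 2 ^ L * p] (mod 2 ^ (m - n))"
  shows "[argument (a * 5 ^ (2 ^ (L - t - 2) * s)) = argument a + 2 ^ (L + n) * (A1 * a ^ k * p)] (mod 2 ^ m)"
proof -
  have "L - 2 = (L - t - 2) + t" using assms(1) by simp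
  then have exponent: "2 ^ (L - t - 2) * s * k = 2 ^ (L - 2) * (k1 * s)"
    by (simp only: k_eq power_add mult_ac)
  have "argument (a * 5 ^ (2 ^ (L - t - 2) * s)) = A1 * a ^ k * (2 ^ n * 5 ^ (2 ^ (L - t - 2) * s * k)) + B"
    unfolding argument_eq by (simp add: power_mult_distrib power_mult)
  also have "\<dots> = A1 * a ^ k * (2 ^ n * 5 ^ (2 ^ (L - 2) * (k1 * s))) + B"
    by (simp only: exponent)
  also have "[\<dots> = A1 * a ^ k * (2 ^ n * (1 + 2 ^ L * p)) + B] (mod 2 ^ m)"
    by (intro cong_add cong_refl cong_scalar_left cong_power_mult[OF power]) simp
  also have "A1 * a ^ k * (2 ^ n * (1 + 2 ^ L * p)) + B = argument a + 2 ^ (L + n) * (A1 * a ^ k * p)"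
    unfolding argument_eq by (simp add: power_add algebra_simps)
  finally show ?thesis .
qed

lemma f_mult_power_5:
  assumes bounds: "t + 2 \<le> L" "L + n \<le> m" "m \<le> 2 * (L + n)"
    and power: "[5 ^ (2 ^ (L - 2) * (k1 * s)) = 1 + 2 ^ L * p] (mod 2 ^ (m - n))"
    and inverse: "[R (L + n) * Rinv * r = 1] (mod 2 ^ (m - (L + n)))"
  shows "f (a * 5 ^ (2 ^ (L - t - 2) * s)) =
    f a * eq (2 ^ (m - (L - t))) (int s * c1 + 2 ^ (n + t) * (slope a * r * p))"
proof -
  define w where "w = A1 * a ^ k * modular_inverse (2 ^ m) (argument a) * Rinv * r * p"
  have w: "[w * R (L + n) * argument a = A1 * a ^ k * p] (mod 2 ^ (m - (L + n)))"
  proof -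
    have "[(argument a * modular_inverse (2 ^ m) (argument a)) * (R (L + n) * Rinv * r) * (A1 * a ^ k * p)
        = 1 * 1 * (A1 * a ^ k * p)] (mod 2 ^ (m - (L + n)))"
      by (intro cong_mult inverse cong_refl cong_power_le[OF argument_inverse]) simp
    then show ?thesis by (simp add: w_def mult_ac)
  qed
  have level: "m - (L - t) = (n + t) + (m - (L + n))" using bounds by simp
  have "chi2 (argument (a * 5 ^ (2 ^ (L - t - 2) * s))) = chi2 (argument a + 2 ^ (L + n) * (A1 * a ^ k * p))"
    by (rule dchar_cong[OF chi2 argument_mult_power_5_cong[OF bounds(1) power]])
  also have "\<dots> = chi2 (argument a) * eq (2 ^ (m - (L + n))) (c2 * w)"
    by (rule dchar_shift[OF chi2 chi2_5 _ bounds(2,3) w]) (use bounds(1) in simp)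
  also have "eq (2 ^ (m - (L + n))) (c2 * w) = eq (2 ^ (m - (L - t))) (2 ^ (n + t) * (slope a * r * p))"
    unfolding level eq_power_two_cancel by (simp add: w_def slope_def mult_ac)
  finally have "chi2 (argument (a * 5 ^ (2 ^ (L - t - 2) * s)))
      = chi2 (argument a) * eq (2 ^ (m - (L - t))) (2 ^ (n + t) * (slope a * r * p))" .
  moreover have "chi1 (a * 5 ^ (2 ^ (L - t - 2) * s)) = chi1 a * eq (2 ^ (m - (L - t))) (int s * c1)"
    unfolding dchar_mult[OF chi1] using dchar_5_power[OF chi1 chi1_5, of "L - t" s] bounds by simp
  ultimately show ?thesis by (simp add: f_def eq_add mult_ac)
qed

lemma f_mult_generator_power:
  "f (a * 5 ^ (2 ^ (level - 2) * s)) = f a * eq (2 ^ (m - level)) (int s * frequency a)"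
proof -
  have "[5 ^ (2 ^ (N - 2) * (k1 * s)) = 1 + 2 ^ N * (int (k1 * s) * R N)] (mod 2 ^ (m - n))"
    using N_ge m_le by (intro cong_power_le[OF power_5_cong]) auto
  moreover have "[R (N + n) * Rinv * 1 = 1] (mod 2 ^ (m - (N + n)))"
    using cong_power_le[OF Rinv, of "m - (N + n)"] by simp
  ultimately have "f (a * 5 ^ (2 ^ (level - 2) * s)) = f a * eq (2 ^ (m - level))
      (int s * c1 + 2 ^ (n + t) * (slope a * 1 * (int (k1 * s) * R N)))"
    using N_ge N_le m_le by (intro f_mult_power_5) auto
  also have "int s * c1 + 2 ^ (n + t) * (slope a * 1 * (int (k1 * s) * R N)) = int s * frequency a"
    by (simp add: frequency_def algebra_simps)
  finally show ?thesis .
qed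

lemma class_sum_even:
  assumes "even a"
  shows "class_sum a = 0"
  unfolding class_sum_def
proof (intro sum.neutral ballI)
  fix x assume "x \<in> {x \<in> {0..<2 ^ m}. [x = a] (mod 2 ^ level)}"
  then have "[x = a] (mod 2 ^ level)" by blast
  then have "[x = a] (mod 2 ^ 1)" by (rule cong_power_le) (use level_bounds(1) in simp)
  then have "even x" using assms by (simp add: cong_iff_dvd_diff)
  then show "f x = 0" by (rule f_even)
qed

lemma class_sum_eq: "class_sum a = (if solution a then 2 ^ (m - level) * f a else 0)"
proof (cases "odd a")
  case True
  have "class_sum a = (\<Sum>s<2 ^ (m - level). f (a * 5 ^ (2 ^ (level - 2) * s) mod 2 ^ m))"
    unfolding class_sum_def
    by (rule sum.reindex_bij_betw[OF bij_betw_power_5_residue_class[OF level_bounds True], symmetric])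
  also have "\<dots> = (\<Sum>s<2 ^ (m - level). f (a * 5 ^ (2 ^ (level - 2) * s)))"
    by (intro sum.cong refl f_cong) (simp only: cong_def mod_mod_trivial)
  also have "\<dots> = (\<Sum>s<2 ^ (m - level). f a * eq (2 ^ (m - level)) (int s * frequency a))"
    by (simp only: f_mult_generator_power)
  also have "\<dots> = f a * (if 2 ^ (m - level) dvd frequency a then 2 ^ (m - level) else 0)"
    using sum_eq_multiples[of "2 ^ (m - level)" "frequency a"] by (simp add: sum_distrib_left[symmetric])
  finally show ?thesis using True by (simp add: solution_iff_dvd_frequency)
qed (simp add: class_sum_even solution_def)

lemma S_eq_sum_residues: "S = (\<Sum>x\<in>{0..<2 ^ m}. f x)"
  unfolding S_def by (intro sum_int_1_atMost_eq_0_lessThan f_cong) (simp_all add: cong_def)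

lemma S_eq_sum_class_sums:
  assumes "inj_on (\<lambda>x. x mod 2 ^ level) X"
    and cover: "\<And>a. solution a \<Longrightarrow> \<exists>x\<in>X. [a = x] (mod 2 ^ level)"
  shows "S = (\<Sum>x\<in>X. class_sum x)"
proof -
  have "S = (\<Sum>a\<in>{0..<2 ^ level}. class_sum a)"
    unfolding S_eq_sum_residues class_sum_def by (rule sum_residue_classes) simp
  also have "\<dots> = (\<Sum>x\<in>X. class_sum x)"
  proof (rule sum_class_representatives)
    show "class_sum a = class_sum b" if "[a = b] (mod 2 ^ level)" for a b
      using that by (simp add: class_sum_def cong_def)
    show "\<exists>x\<in>X. [a = x] (mod 2 ^ level)" if "class_sum a \<noteq> 0" for a
      using that cover by (simp add: class_sum_eq split: if_splits)
  qed (use assms(1) in simp_all)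
  finally show ?thesis .
qed

lemma S_nonzero_imp_solution: "S \<noteq> 0 \<Longrightarrow> \<exists>a. solution a"
  using S_eq_sum_class_sums[of "{}"] by auto

lemma S_nonzero_imp_chi1_even:
  assumes "even k" "S \<noteq> 0"
  shows "chi1 (- 1) = 1"
proof (rule ccontr)
  assume "chi1 (- 1) \<noteq> 1"
  then have minus: "f (- x) = - f x" for x
    using f_minus[OF assms(1)] dchar_minus_1[OF chi1] by auto
  have "S = (\<Sum>x\<in>{0..<2 ^ m}. f (2 ^ m - x))"
    unfolding S_def by (rule sum.reindex_bij_witness[of _ "\<lambda>x. 2 ^ m - x" "\<lambda>x. 2 ^ m - x"]) auto
  also have "\<dots> = (\<Sum>x\<in>{0..<2 ^ m}. - f x)"
    unfolding minus[symmetric] by (intro sum.cong refl f_cong) (simp add: cong_def)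
  also have "\<dots> = - S" by (simp add: S_eq_sum_residues sum_negf)
  finally show False using assms(2) by simp
qed

lemma C_eq_factored:
  assumes "c1 = 2 ^ (n + t) * c3"
  shows "C x = 2 ^ (n + t) * (c3 * argument x + c2 * A1 * int k1 * x ^ k * R N * Rinv)"
  unfolding C_eq using assms by (simp add: distrib_left mult.assoc)

lemma odd_C_coefficient: "odd x \<Longrightarrow> odd (c2 * A1 * int k1 * x ^ k * R N * Rinv)"
  using odd_c2 odd_A1 odd_k1 odd_Rinv odd_R[of N] N_ge by simp

lemma solution_imp_dvd_c1:
  assumes "solution a"
  shows "2 ^ (n + t) dvd c1"
proof -
  have "2 ^ (m - level) dvd frequency a"
    using assms by (simp add: solution_iff_dvd_frequency)
  then have "2 ^ (n + t) dvd frequency a"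
    by (rule power_le_dvd) (simp add: modulus_level)
  then show ?thesis by (simp add: frequency_def dvd_add_left_iff)
qed

lemma solution_imp_c1_eq:
  assumes "solution a" "N + n < m \<or> N = t + 2" "1 \<le> c1" "c1 \<le> 2 ^ (m - 2)"
  shows "\<exists>c3. odd c3 \<and> c1 = 2 ^ (n + t) * c3"
proof (cases "N + n < m")
  case True
  obtain c3 where c3: "c1 = 2 ^ (n + t) * c3"
    using solution_imp_dvd_c1[OF assms(1)] by (elim dvdE)
  have "2 ^ (m - level) dvd C a" using assms(1) by (simp add: solution_def)
  then have "2 ^ Suc (n + t) dvd C a"
    by (rule power_le_dvd) (use True in \<open>simp add: modulus_level\<close>)
  then have "2 ^ (n + t) * 2 dvd C a" by (simp only: power_Suc2)
  then have "even (c3 * argument a + c2 * A1 * int k1 * a ^ k * R N * Rinv)"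
    unfolding C_eq_factored[OF c3] by (simp only: dvd_mult_cancel_left) simp
  then have "odd c3" using odd_C_coefficient[of a] odd_argument[of a] assms(1) by (simp add: solution_def)
  then show ?thesis using c3 by blast
next
  case False
  then have "m - 2 = n + t" using assms(2) N_le by simp
  then have "c1 = 2 ^ (n + t) * 1"
    using solution_imp_dvd_c1[OF assms(1)] assms(3,4) zdvd_imp_le[of "2 ^ (n + t)" c1] by simp
  then show ?thesis using odd_one by blast
qed

lemma S_nonzero_imp:
  assumes "S \<noteq> 0" "N + n < m \<or> N = t + 2" "1 \<le> c1" "c1 \<le> 2 ^ (m - 2)"
  shows "(\<exists>c3. odd c3 \<and> c1 = 2 ^ (n + t) * c3) \<and> (even k \<longrightarrow> chi1 (- 1) = 1) \<and> (\<exists>a. solution a)"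
  using S_nonzero_imp_solution[OF assms(1)] S_nonzero_imp_chi1_even[OF _ assms(1)]
    solution_imp_c1_eq[OF _ assms(2-4)] by blast

subsection \<open>The sum in the range \<open>m - n \<le> 2 * t + 4\<close>\<close>

lemma f_1: "f 1 = chi2 (A + B)"
  by (simp add: f_def argument_def dchar_1[OF chi1])

lemma f_minus_1: "odd k \<Longrightarrow> f (- 1) = chi1 (- 1) * chi2 (- A + B)"
  by (simp add: f_def argument_def)

lemma two_power_m_minus_1: "(2::complex) ^ (m - Suc 0) = 2 * 2 ^ (m - 2)"
proof -
  have "m - Suc 0 = Suc (m - 2)" using m_ge_3 by simp
  then show ?thesis by simp
qed

lemma S_two_classes:
  assumes "N = t + 2"
  shows "S = 2 ^ (m - 2) * ((if 2 ^ (m - 2) dvd C 1 then f 1 else 0)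
      + (if 2 ^ (m - 2) dvd C (- 1) then f (- 1) else 0))"
proof -
  have level: "level = 2" using assms by simp
  have "S = (\<Sum>x\<in>{1, - 1}. class_sum x)"
  proof (rule S_eq_sum_class_sums)
    show "\<exists>x\<in>{1, - 1}. [a = x] (mod 2 ^ level)" if "solution a" for a
      using that cong_mod_4_odd_cases[of a] by (auto simp: level solution_def)
  qed (auto simp: level inj_on_def)
  then show ?thesis by (simp add: class_sum_eq solution_def level distrib_left)
qed

lemma not_solution_1_and_minus_1:
  assumes "odd k" "even c1" "n + 4 \<le> m"
  shows "\<not> (2 ^ (m - 2) dvd C 1 \<and> 2 ^ (m - 2) dvd C (- 1))"
proof
  assume "2 ^ (m - 2) dvd C 1 \<and> 2 ^ (m - 2) dvd C (- 1)"
  then have "2 ^ (m - 2) dvd C 1 - C (- 1)" by (intro dvd_diff) auto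
  then have "2 ^ (n + 2) dvd C 1 - C (- 1)"
    by (rule power_le_dvd) (use assms(3) in simp)
  moreover have "C 1 - C (- 1) = 2 * A * (c1 + c2 * int k * R N * Rinv)"
    using assms(1) by (simp add: C_def argument_def algebra_simps)
  ultimately have "2 ^ (n + 1) * 2 dvd 2 ^ (n + 1) * (A1 * (c1 + c2 * int k * R N * Rinv))"
    by (simp add: A_eq mult_ac)
  then have "even (A1 * (c1 + c2 * int k * R N * Rinv))"
    by (simp only: dvd_mult_cancel_left) simp
  then show False
    using assms(1,2) odd_A1 odd_c2 odd_Rinv odd_R[of N] N_ge by simp
qed

lemma S_middle_range:
  assumes N: "N = t + 2" and "t + 3 < m - n" and "2 ^ (n + t) dvd c1"
    and even_k: "even k \<Longrightarrow> chi1 (- 1) = 1"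
  shows "S = (if even k \<and> [C 1 = 0] (mod 2 ^ (m - 2)) then 2 ^ (m - 1) * chi2 (A + B)
     else if odd k \<and> [C 1 = 0] (mod 2 ^ (m - 2)) then 2 ^ (m - 2) * chi2 (A + B)
     else if odd k \<and> [C (- 1) = 0] (mod 2 ^ (m - 2)) then 2 ^ (m - 2) * chi1 (- 1) * chi2 (- A + B)
     else 0)"
proof (cases "even k")
  case True
  then have "C (- 1) = C 1" "f (- 1) = f 1"
    using even_k f_minus[of 1] by (simp_all add: C_def argument_def)
  then show ?thesis
    using True by (simp add: S_two_classes[OF N] cong_0_iff f_1 two_power_m_minus_1)
next
  case False
  have "even c1" using assms(3) n_pos by (meson add_pos_nonneg dvd_power dvd_trans le0)
  then have "\<not> (2 ^ (m - 2) dvd C 1 \<and> 2 ^ (m - 2) dvd C (- 1))"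
    using False assms(2) by (intro not_solution_1_and_minus_1) auto
  then show ?thesis
    using False by (auto simp: S_two_classes[OF N] cong_0_iff f_1 f_minus_1)
qed

lemma S_range_t_plus_3:
  assumes m: "m - n = t + 3" and N: "N = t + 2" and c3: "c1 = 2 ^ (n + t) * c3" "odd c3"
    and even_k: "even k \<Longrightarrow> chi1 (- 1) = 1"
  shows "S = (if even k \<and> (chi1 5 = 1 \<or> chi1 5 = -1) \<and> chi1 (-1) = 1 then 2 ^ (m - 1) * chi2 (A + B)
     else if odd k \<and> (chi1 5 = 1 \<or> chi1 5 = -1)
       then 2 ^ (m - 2) * (chi2 (A + B) + chi1 (-1) * chi2 (- A + B))
     else 0)"
proof -
  have m_minus_2: "m - 2 = n + t + 1" using m by simp
  have "chi1 5 = eq (2 ^ (n + t + 1)) (2 ^ (n + t) * c3)" by (simp only: chi1_5 c3(1) m_minus_2)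
  also have "\<dots> = - 1" unfolding eq_power_two_cancel using eq_2_odd[OF c3(2)] by simp
  finally have chi1_5: "chi1 5 = - 1" .
  have "2 ^ (m - 2) dvd C a" if "odd a" for a
  proof -
    have "even (c3 * argument a + c2 * A1 * int k1 * a ^ k * R N * Rinv)"
      using odd_C_coefficient[OF that] odd_argument[of a] c3(2) by simp
    then show ?thesis unfolding m_minus_2 C_eq_factored[OF c3(1)] by (simp add: mult_dvd_mono mult.commute)
  qed
  then have "S = 2 ^ (m - 2) * (f 1 + f (- 1))" by (simp add: S_two_classes[OF N])
  then show ?thesis
    using even_k chi1_5 f_minus[of 1] by (auto simp: f_1 f_minus_1 two_power_m_minus_1)
qed

lemma S_range_t_plus_2:
  assumes m: "m - n = t + 2" and N: "N = t + 2" and c1: "2 ^ (n + t) dvd c1"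
    and even_k: "even k \<Longrightarrow> chi1 (- 1) = 1"
  shows "S = (if (even k \<and> chi1 = chi0_2) \<or> (odd k \<and> chi1 = chi4)
     then 2 ^ (m - 1) * chi2 (A + B) else 0)"
proof -
  have m_minus_2: "m - 2 = n + t" using m by simp
  have "chi1 5 = 1" using c1 by (simp add: chi1_5 m_minus_2 eq_eq_1_iff)
  then have chi1_cases: "chi1 = chi0_2 \<longleftrightarrow> chi1 (- 1) = 1" "chi1 = chi4 \<longleftrightarrow> chi1 (- 1) = - 1"
    using dchar_trivial_at_5_iff[OF chi1] m_ge_3 by simp_all
  have "2 ^ (m - 2) dvd C a" for a using c1 unfolding m_minus_2 C_eq by simp
  then have S: "S = 2 ^ (m - 2) * (f 1 + f (- 1))" by (simp add: S_two_classes[OF N])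
  show ?thesis
  proof (cases "even k")
    case True
    then show ?thesis
      unfolding chi1_cases S using even_k f_minus[of 1] by (simp add: f_1 two_power_m_minus_1)
  next
    case False
    then have "t = 0" by (cases t) (auto simp: k_eq)
    then have "m - 1 = Suc n" using m by simp
    then have "- A + B = (A + B) + 2 ^ (m - 1) * - A1" by (simp add: A_eq)
    also have "chi2 \<dots> = chi2 (A + B) * eq 2 (c2 * - A1)"
      using odd_argument[of 1] m_ge_3 by (intro dchar_shift_half_modulus[OF chi2 chi2_5]) (simp_all add: argument_def)
    also have "\<dots> = - chi2 (A + B)" using odd_c2 odd_A1 by (simp add: eq_2_odd)
    finally have "f (- 1) = - chi1 (- 1) * f 1" using False by (simp add: f_1 f_minus_1)
    then show ?thesis
      unfolding chi1_cases S using False dchar_minus_1[OF chi1] by (auto simp: f_1 two_power_m_minus_1)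
  qed
qed

subsection \<open>The sum in the range \<open>m - n > 2 * t + 4\<close>\<close>

lemma C_diff:
  assumes "c1 = 2 ^ (n + t) * c3"
  shows "C a - C b = 2 ^ (n + t) * ((c3 * A + c2 * A1 * int k1 * R N * Rinv) * (a ^ k - b ^ k))"
  unfolding C_eq_factored[OF assms] argument_def by (simp add: algebra_simps)

lemma solution_iff_power_cong:
  assumes "c1 = 2 ^ (n + t) * c3" "solution a" "odd b"
  shows "solution b \<longleftrightarrow> [b ^ k = a ^ k] (mod 2 ^ (m - (N + n)))"
proof -
  have "odd (c3 * A + c2 * A1 * int k1 * R N * Rinv)"
    using odd_C_coefficient[of 1] n_pos by (simp add: A_eq)
  then have coprime: "coprime (2 ^ (m - (N + n))) (c3 * A + c2 * A1 * int k1 * R N * Rinv)" by simp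
  have "solution b \<longleftrightarrow> 2 ^ (m - level) dvd C b - C a"
    using assms(2,3) by (simp add: solution_def dvd_diff_left_iff)
  also have "\<dots> \<longleftrightarrow> 2 ^ (m - (N + n)) dvd (c3 * A + c2 * A1 * int k1 * R N * Rinv) * (b ^ k - a ^ k)"
    unfolding C_diff[OF assms(1)] modulus_level power_add[of _ "n + t"]
    by (simp only: dvd_mult_cancel_left) simp
  also have "\<dots> \<longleftrightarrow> 2 ^ (m - (N + n)) dvd b ^ k - a ^ k"
    by (rule coprime_dvd_mult_right_iff[OF coprime])
  finally show ?thesis by (simp add: cong_iff_dvd_diff)
qed

lemma solutions_cong:
  assumes "c1 = 2 ^ (n + t) * c3" "solution a" "solution b"
  shows "[b = a] (mod 2 ^ (m - (N + n) - t)) \<or> t > 0 \<and> [b = - a] (mod 2 ^ (m - (N + n) - t))"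
proof -
  have "[b ^ k = a ^ k] (mod 2 ^ (m - (N + n)))"
    using solution_iff_power_cong[OF assms(1,2), of b] assms(3) by (simp add: solution_def)
  then have "[b ^ (2 ^ t * k1) = a ^ (2 ^ t * k1)] (mod 2 ^ (m - (N + n)))"
    by (simp only: k_eq)
  then show ?thesis
    using assms(2,3) odd_k1 by (intro equal_powers_cong) (simp_all add: solution_def)
qed

lemma S_eq_sum_up_to_sign:
  assumes even_k: "even k \<Longrightarrow> chi1 (- 1) = 1" and "finite X"
    and solution: "\<And>x. x \<in> X \<Longrightarrow> solution x"
    and mod_4: "\<And>x y. x \<in> X \<Longrightarrow> y \<in> X \<Longrightarrow> [x = y] (mod 4)"
    and inj: "inj_on (\<lambda>x. x mod 2 ^ level) X"
    and cover: "\<And>a. solution a \<Longrightarrow>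
      \<exists>x\<in>X. [a = x] (mod 2 ^ level) \<or> t > 0 \<and> [a = - x] (mod 2 ^ level)"
  shows "S = 2 ^ (m - level + min 1 t) * (\<Sum>x\<in>X. f x)"
proof -
  have class_sums: "(\<Sum>x\<in>X. class_sum x) = 2 ^ (m - level) * (\<Sum>x\<in>X. f x)"
    by (simp add: class_sum_eq solution sum_distrib_left)
  show ?thesis
  proof (cases "t = 0")
    case True
    then have "S = (\<Sum>x\<in>X. class_sum x)"
      using cover by (intro S_eq_sum_class_sums inj) simp
    then show ?thesis unfolding class_sums using True by simp
  next
    case False
    then have k: "even k" by (simp add: k_eq)
    have not_cong_minus: "\<not> [x = - y] (mod 2 ^ level)" if "x \<in> X" "y \<in> X" for x y
    proof
      assume "[x = - y] (mod 2 ^ level)"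
      then have "[x = - y] (mod 2 ^ 2)" using level_bounds(1) by (rule cong_power_le)
      then show False
        using not_cong_minus_mod_4[OF _ mod_4[OF that]] solution[OF that(1)] by (simp add: solution_def)
    qed
    have class_sum_minus: "class_sum (- x) = class_sum x" for x
      by (simp add: class_sum_eq solution_minus[OF k] f_minus[OF k] even_k[OF k])
    have "\<exists>x\<in>X \<union> uminus ` X. [a = x] (mod 2 ^ level)" if "solution a" for a
      using cover[OF that] by auto
    then have "S = (\<Sum>x\<in>X \<union> uminus ` X. class_sum x)"
      by (intro S_eq_sum_class_sums inj_on_mod_Un_uminus inj not_cong_minus)
    also have "\<dots> = (\<Sum>x\<in>X. class_sum x) + (\<Sum>x\<in>uminus ` X. class_sum x)"
      using \<open>finite X\<close> inj_on_mod_Un_uminus(2)[OF inj not_cong_minus]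
      by (intro sum.union_disjoint) auto
    also have "(\<Sum>x\<in>uminus ` X. class_sum x) = (\<Sum>x\<in>X. class_sum x)"
      by (simp add: sum.reindex class_sum_minus)
    finally show ?thesis using False by (simp add: class_sums)
  qed
qed

lemma S_large_range_even:
  assumes c1: "c1 = 2 ^ (n + t) * c3" and N: "m - n = 2 * N"
    and x0: "solution x0" and even_k: "even k \<Longrightarrow> chi1 (- 1) = 1"
  shows "S = 2 ^ (m - level + min 1 t) * f x0"
proof -
  have "m - (N + n) - t = level" using N by simp
  then have "S = 2 ^ (m - level + min 1 t) * (\<Sum>x\<in>{x0}. f x)"
    using solutions_cong[OF c1 x0] x0 by (intro S_eq_sum_up_to_sign even_k) auto
  then show ?thesis by simp
qed

lemma solution_slope_cong:
  assumes c1: "c1 = 2 ^ (n + t) * c3" and m: "m = n + 2 * N - 1"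
    and C: "C x = lam * 2 ^ (m - level)"
  shows "[c3 + slope x * int k1 * R N = 2 ^ (N - 1) * lam] (mod 2 ^ N)"
proof -
  have exponents: "N - 1 + (n + t) = m - level" "N + (n + t) \<le> m" "N = Suc (N - 1)"
    using N_ge m by auto
  have "frequency x = 2 ^ (n + t) * (c3 + slope x * int k1 * R N)"
    unfolding frequency_def by (simp add: c1 distrib_left)
  then have "argument x * frequency x = 2 ^ (n + t) * (argument x * (c3 + slope x * int k1 * R N))"
    by (simp only: mult.left_commute)
  moreover have "[argument x * frequency x = C x] (mod 2 ^ (n + t) * 2 ^ N)"
    using cong_power_le[OF cong_sym[OF C_cong_frequency] exponents(2)] by (simp only: power_add mult.commute)
  moreover have "C x = 2 ^ (n + t) * (2 ^ (N - 1) * lam)"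
    unfolding C exponents(1)[symmetric] by (simp add: power_add)
  ultimately have "2 ^ (n + t) * 2 ^ N dvd
      2 ^ (n + t) * (argument x * (c3 + slope x * int k1 * R N) - 2 ^ (N - 1) * lam)"
    by (simp only: cong_iff_dvd_diff right_diff_distrib)
  then have "[argument x * (c3 + slope x * int k1 * R N) = 2 ^ (N - 1) * lam] (mod 2 ^ N)"
    by (simp add: cong_iff_dvd_diff)
  then show ?thesis
    using odd_cong_half_modulus_cancel[OF odd_argument] exponents(3) by metis
qed

text \<open>
  The multiplier is a square root of the generator in \<open>f_mult_generator_power\<close>, so its expansion
  involves \<open>R (N - 1)\<close> and \<open>R (N + n - 1)\<close>; passing to \<open>R N\<close> and \<open>R (N + n)\<close>, as they occur in
  \<open>C\<close>, produces the terms of \<open>h\<close> other than \<open>2 * lam\<close>.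
\<close>
lemma f_mult_half_generator:
  assumes c1: "c1 = 2 ^ (n + t) * c3" "odd c3" and m: "m = n + 2 * N - 1" and N: "t + 3 \<le> N"
    and x0: "odd x0" "C x0 = lam * 2 ^ (m - level)"
    and h: "h = 2 * lam + (int k1 - 1) + (2 ^ n - 1) * c3"
  shows "f (x0 * 5 ^ 2 ^ (level - 3)) = f x0 * eq 4 h"
proof -
  define L where "L = N - 1"
  have N_Suc: "N = Suc L" and L_bounds: "t + 2 \<le> L" "2 \<le> L" "L + n \<le> m" "m \<le> 2 * (L + n)"
    using N m n_pos by (auto simp: L_def)
  have exponents: "m - n = 2 * L + 1" "m - (L + n) = N" "L + n - 1 = N + n - 2"
    "m - (L - t) = (n + t) + N" "L - t - 2 = level - 3"
    using N m n_pos by (auto simp: L_def)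
  have power: "[5 ^ (2 ^ (L - 2) * (k1 * 1)) = 1 + 2 ^ L * (int k1 * R N - 2 ^ (N - 2))] (mod 2 ^ (m - n))"
    using odd_power_5_cong[OF L_bounds(2) odd_k1] by (simp add: N_Suc exponents(1))
  have inverse: "[R (L + n) * Rinv * (1 + 2 ^ (N + n - 2)) = 1] (mod 2 ^ (m - (L + n)))"
  proof -
    have "[R (Suc (L + n)) * Rinv = 1] (mod 2 ^ (L + n))"
      using cong_power_le[OF Rinv L_bounds(3)] by (simp add: N_Suc)
    from R_mult_inverse_R_Suc[OF _ this]
    have "[R (L + n) * Rinv * (1 + 2 ^ (N + n - 2)) = 1] (mod 2 ^ (L + n))"
      using L_bounds(2) by (simp only: exponents(3))
    then show ?thesis by (rule cong_power_le) (use L_bounds(4) in simp)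
  qed
  define E where "E = c3 + slope x0 * (1 + 2 ^ (N + n - 2)) * (int k1 * R N - 2 ^ (N - 2))"
  have "[E = 2 ^ (N - 2) * h] (mod 2 ^ N)"
    unfolding E_def h using N n_pos odd_slope[OF x0(1)] c1(2) odd_k1
    by (intro half_generator_exponent_cong R_mod_4 solution_slope_cong[OF c1(1) m x0(2)]) auto
  then have "eq (2 ^ N) E = eq (2 ^ N) (2 ^ (N - 2) * h)" by (intro eq_cong) simp
  also have "\<dots> = eq 4 h"
  proof -
    have "N = (N - 2) + 2" using N by simp
    then show ?thesis using eq_power_two_cancel[of "N - 2" 2 h] by simp
  qed
  finally have "eq (2 ^ N) E = eq 4 h" .
  moreover have "f (x0 * 5 ^ (2 ^ (L - t - 2) * 1)) = f x0 * eq (2 ^ ((n + t) + N)) (2 ^ (n + t) * E)"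
    unfolding f_mult_power_5[OF L_bounds(1,3,4) power inverse] exponents(4)
    by (simp add: E_def c1(1) algebra_simps)
  ultimately show ?thesis by (simp only: exponents(5) mult_1_right eq_power_two_cancel)
qed

lemma solution_mult_half_generator:
  assumes c1: "c1 = 2 ^ (n + t) * c3" and m: "m = n + 2 * N - 1" and N: "t + 3 \<le> N"
    and a: "solution a"
  shows "solution (a * 5 ^ 2 ^ (level - 3))"
proof -
  have "N - 1 - 2 = (level - 3) + t" using N by simp
  then have "2 ^ (level - 3) * k = 2 ^ (N - 1 - 2) * k1"
    by (simp only: k_eq power_add mult.assoc)
  then have "(a * 5 ^ 2 ^ (level - 3)) ^ k = a ^ k * 5 ^ (2 ^ (N - 1 - 2) * k1)"
    by (simp only: power_mult_distrib power_mult[symmetric])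
  also have "[\<dots> = a ^ k * 1] (mod 2 ^ (N - 1))"
    using N by (intro cong_scalar_left power_5_cong_1) simp
  moreover have "m - (N + n) = N - 1" using m by simp
  ultimately show ?thesis
    using a solution_iff_power_cong[OF c1 a, of "a * 5 ^ 2 ^ (level - 3)"] by (simp add: solution_def)
qed

lemma S_large_range_odd:
  assumes c1: "c1 = 2 ^ (n + t) * c3" "odd c3" and m: "m = n + 2 * N - 1" and N: "t + 3 \<le> N"
    and x0: "odd x0" "C x0 = lam * 2 ^ (m - level)" and even_k: "even k \<Longrightarrow> chi1 (- 1) = 1"
    and h: "h = 2 * lam + (int k1 - 1) + (2 ^ n - 1) * c3"
  shows "S = 2 ^ (m - level + min 1 t) * f x0 * (1 + eq 4 h)"
proof -
  define l where "l = level - 1"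
  have level: "level = Suc l" "level - 3 = l - 2" "m - (N + n) - t = l" and l: "2 \<le> l"
    using N m by (auto simp: l_def)
  define u :: int where "u = 5 ^ 2 ^ (l - 2)"
  have u: "[u = 1] (mod 2 ^ l)" "\<not> [u = 1] (mod 2 ^ level)"
    using power_5_cong_1[OF l, of 1] power_5_not_cong_1[OF l] by (simp_all add: u_def level(1))
  have solutions: "solution x0" "solution (x0 * u)"
  proof -
    show "solution x0" using x0 by (simp add: solution_def)
    then show "solution (x0 * u)"
      unfolding u_def level(2)[symmetric] by (rule solution_mult_half_generator[OF c1(1) m N])
  qed
  have mod_4: "[x0 * u = x0] (mod 4)"
    using cong_scalar_left[OF cong_power_le[OF u(1) l], of x0] by simp
  have distinct: "x0 * u mod 2 ^ level \<noteq> x0 mod 2 ^ level"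
    using u(2) x0(1) cong_mult_lcancel[of x0 "2 ^ level" u 1] by (simp add: cong_def)
  have "S = 2 ^ (m - level + min 1 t) * (\<Sum>x\<in>{x0, x0 * u}. f x)"
  proof (intro S_eq_sum_up_to_sign even_k)
    show "\<exists>x\<in>{x0, x0 * u}. [a = x] (mod 2 ^ level) \<or> t > 0 \<and> [a = - x] (mod 2 ^ level)"
      if "solution a" for a
      using solutions_cong[OF c1(1) solutions(1) that] x0(1)
        cong_power_two_Suc_cases[OF l, of x0 a] cong_power_two_Suc_cases[OF l, of "- x0" a]
      unfolding level(1,3) u_def by auto
    show "inj_on (\<lambda>x. x mod 2 ^ level) {x0, x0 * u}"
      using distinct by (auto simp: inj_on_def)
    show "[x = y] (mod 4)" if "x \<in> {x0, x0 * u}" "y \<in> {x0, x0 * u}" for x y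
      using that mod_4 cong_sym[OF mod_4] by auto
  qed (use solutions in auto)
  also have "(\<Sum>x\<in>{x0, x0 * u}. f x) = f x0 + f (x0 * u)"
    using distinct by (subst sum.insert) auto
  also have "\<dots> = f x0 * (1 + eq 4 h)"
    using f_mult_half_generator[OF c1 m N x0 h] unfolding u_def level(2) by (simp add: distrib_left)
  finally show ?thesis by (simp add: mult.assoc)
qed

lemma modulus_large_range:
  assumes "N = (m - n + 1) div 2"
  shows "m - level = (m + n) div 2 + t"
  using assms N_ge N_le by linarith

lemma solution_large_range_iff:
  assumes "N = (m - n + 1) div 2"
  shows "solution x \<longleftrightarrow>
    odd (x * (A * x ^ k + B)) \<and> [C x = 0] (mod 2 ^ ((m + n) div 2 + t))"
  using odd_argument[of x] unfolding solution_def modulus_large_range[OF assms] argument_def by (simp add: cong_0_iff)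

lemma S_large_range:
  assumes N: "N = (m - n + 1) div 2" "2 * t + 4 < m - n" and c1: "c1 = 2 ^ (n + t) * c3" "odd c3"
    and even_k: "even k \<Longrightarrow> chi1 (- 1) = 1"
    and x0: "odd x0" "C x0 = lam * 2 ^ ((m + n) div 2 + t)"
    and h: "h = 2 * lam + (int k1 - 1) + (2 ^ n - 1) * c3"
  shows "S = of_real (2 powr (real (m + n) / 2 + real t + real (min 1 t))) * f x0
    * (if even (m - n) then 1 else exp (\<i> * of_real pi / 4) powi h * of_int (jacobi 2 h))"
proof -
  define M :: complex where "M = 2 ^ ((m + n) div 2 + (t + min 1 t))"
  note modulus = modulus_large_range[OF N(1)]
  have M: "2 ^ (m - level + min 1 t) = M" by (simp only: M_def modulus add.assoc)
  have "\<not> m < n" using N_le by simp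
  have "odd h" unfolding h using c1(2) odd_k1 n_pos by simp
  have powr: "of_real (2 powr (real (m + n) / 2 + real t + real (min 1 t)))
      = M * (if even (m - n) then 1 else of_real (sqrt 2))"
    using two_powr_half_add[of "m + n" "t + min 1 t"] \<open>\<not> m < n\<close> by (simp add: M_def add.assoc)
  have C_x0: "C x0 = lam * 2 ^ (m - level)" using x0(2) by (simp only: modulus)
  show ?thesis
  proof (cases "even (m - n)")
    case True
    then have "m - n = 2 * N" unfolding N(1) by presburger
    moreover have "solution x0" using x0(1) C_x0 by (simp add: solution_def)
    ultimately have "S = M * f x0"
      unfolding M[symmetric] by (rule S_large_range_even[OF c1(1) _ _ even_k])
    then show ?thesis using True by (simp only: powr) simp
  next
    case False
    then have "m = n + 2 * N - 1" "t + 3 \<le> N" using N by presburger+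
    then have "S = M * f x0 * (1 + eq 4 h)"
      unfolding M[symmetric] by (rule S_large_range_odd[OF c1 _ _ x0(1) C_x0 even_k h])
    then show ?thesis using False by (simp only: powr one_plus_eq_4[OF \<open>odd h\<close>]) simp
  qed
qed

end

theorem theorem1p1:
  fixes m n t k k1 :: nat and A A1 B c1 c2 Rinv :: int
    and chi1 chi2 :: "int \<Rightarrow> complex"
    and N :: nat and S :: complex and C :: "int \<Rightarrow> int"
  assumes hm: "m \<ge> 3"
    and hchi1: "dchar (2 ^ m) chi1"
    and hchi2: "primitive_dchar (2 ^ m) chi2"
    and hk: "k \<ge> 1"
    and hA: "A = 2 ^ n * A1" and hn: "n > 0"
    and hkt: "k = 2 ^ t * k1"
    and hodd: "odd A1" "odd k1" "odd B"
    and hc1: "chi1 5 = eq (2 ^ (m - 2)) c1" "1 \<le> c1" "c1 \<le> 2 ^ (m - 2)"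
    and hc2: "chi2 5 = eq (2 ^ (m - 2)) c2" "1 \<le> c2" "c2 \<le> 2 ^ (m - 2)"
    and hS: "S = (\<Sum>x\<in>{1..2 ^ m}. chi1 x * chi2 (A * x ^ k + B))"
    and hN: "N = (if m - n > 2 * t + 4 then (m - n + 1) div 2 else t + 2)"
    and hRinv: "[R (N + n) * Rinv = 1] (mod 2 ^ m)"
    and hC: "C = (\<lambda>x. c1 * (A * x ^ k + B) + c2 * A * int k * x ^ k * R N * Rinv)"
    and hmn: "m - n \<ge> t + 2"
  shows
    "(\<not> ((\<exists>c3. odd c3 \<and> c1 = 2 ^ (n + t) * c3)
          \<and> (even k \<longrightarrow> chi1 (-1) = 1)
          \<and> (m - n > 2 * t + 4 \<longrightarrow>
               (\<exists>x0. odd (x0 * (A * x0 ^ k + B)) \<and>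
                  [C x0 = 0] (mod 2 ^ ((m + n) div 2 + t))))) \<longrightarrow> S = 0)
     \<and>
     (((\<exists>c3. odd c3 \<and> c1 = 2 ^ (n + t) * c3)
          \<and> (even k \<longrightarrow> chi1 (-1) = 1)
          \<and> (m - n > 2 * t + 4 \<longrightarrow>
               (\<exists>x0. odd (x0 * (A * x0 ^ k + B)) \<and>
                  [C x0 = 0] (mod 2 ^ ((m + n) div 2 + t))))) \<longrightarrow>
       (m - n > 2 * t + 4 \<longrightarrow>
          (\<forall>x0 lam. odd (x0 * (A * x0 ^ k + B)) \<and> C x0 = lam * 2 ^ ((m + n) div 2 + t) \<longrightarrow>
             (let c3 = c1 div 2 ^ (n + t);
                  h = 2 * lam + (int k1 - 1) + (2 ^ n - 1) * c3;
                  \<omega> = exp (\<i> * of_real pi / 4)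
              in S = of_real (2 powr (real (m + n) / 2 + real t + real (min 1 t)))
                      * chi1 x0 * chi2 (A * x0 ^ k + B)
                      * (if even (m - n) then 1 else \<omega> powi h * of_int (jacobi 2 h)))))
       \<and>
       (t + 3 < m - n \<and> m - n \<le> 2 * t + 4 \<longrightarrow>
          S = (if even k \<and> [C 1 = 0] (mod 2 ^ (m - 2)) then 2 ^ (m - 1) * chi2 (A + B)
               else if odd k \<and> [C 1 = 0] (mod 2 ^ (m - 2)) then 2 ^ (m - 2) * chi2 (A + B)
               else if odd k \<and> [C (-1) = 0] (mod 2 ^ (m - 2))
                 then 2 ^ (m - 2) * chi1 (-1) * chi2 (- A + B)
               else 0))
       \<and>
       (m - n = t + 3 \<longrightarrow>
          S = (if even k \<and> (chi1 5 = 1 \<or> chi1 5 = -1) \<and> chi1 (-1) = 1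
                 then 2 ^ (m - 1) * chi2 (A + B)
               else if odd k \<and> (chi1 5 = 1 \<or> chi1 5 = -1)
                 then 2 ^ (m - 2) * (chi2 (A + B) + chi1 (-1) * chi2 (- A + B))
               else 0))
       \<and>
       (m - n = t + 2 \<longrightarrow>
          S = (if (even k \<and> chi1 = chi0_2) \<or> (odd k \<and> chi1 = chi4)
                 then 2 ^ (m - 1) * chi2 (A + B) else 0)))"
proof -
  interpret T: two_power_sum m n t k k1 N A A1 B c1 c2 Rinv chi1 chi2
  proof unfold_locales
    show "dchar (2 ^ m) chi2" using hchi2 by (simp add: primitive_dchar_def)
    show "odd c2" by (rule primitive_dchar_exponent_odd[OF hm hchi2 hc2(1)])
    show "t + 2 \<le> N" "N + n \<le> m" "m \<le> 2 * N + n" using hN hmn by (auto split: if_splits)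
  qed fact+
  have S: "S = T.S" and C: "C = T.C"
    by (auto simp: hS hC T.S_def T.f_def T.C_def T.argument_def)
  have N: "m - n > 2 * t + 4 \<Longrightarrow> N = (m - n + 1) div 2" "m - n \<le> 2 * t + 4 \<Longrightarrow> N = t + 2"
    using hN by simp_all
  show ?thesis (is "(\<not> ?P \<longrightarrow> _) \<and> (?P \<longrightarrow> ?i \<and> ?ii \<and> ?iii \<and> ?iv)")
  proof (intro conjI[of "\<not> ?P \<longrightarrow> S = 0"] impI)
    have "N + n < m \<or> N = t + 2" using hN hmn by auto
    then show "S = 0" if "\<not> ?P"
      using that T.S_nonzero_imp[OF _ _ hc1(2,3)] T.solution_large_range_iff[OF N(1)]
      unfolding S C by blast
  next
    assume ?P
    then obtain c3 where c3: "c1 = 2 ^ (n + t) * c3" "odd c3"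
      and even_k: "even k \<Longrightarrow> chi1 (- 1) = 1" by blast
    have ?i
      using T.S_large_range[OF N(1) _ c3 even_k] c3(1)
      by (simp add: Let_def S C T.f_def T.argument_def mult.assoc)
    moreover have ?ii
      using T.S_middle_range[OF N(2) _ dvdI[OF c3(1)] even_k] unfolding S C by blast
    moreover have ?iii
      using T.S_range_t_plus_3[OF _ N(2) c3 even_k] unfolding S by simp
    moreover have ?iv
      using T.S_range_t_plus_2[OF _ N(2) dvdI[OF c3(1)] even_k] unfolding S by simp
    ultimately show "?i \<and> ?ii \<and> ?iii \<and> ?iv" by blast
  qed
qed

end
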